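(* Let $N>N_1>\cdots>N_M$ be integers with $N>0$ and $N_M<0$. Let $$L=\mathcal S^{N}+u_1\mathcal S^{N_1}+\cdots+u_M\mathcal S^{N_M},$$ where $u_1,\dots,u_M$ are free generators over $\mathbb C$ of the commutative algebra $\mathcal A$ of difference polynomials. Put $p=\gcd(N-N_1,\dots,N-N_M)$, $q=p/\gcd(p,N)$, $m=(N-N_M)/p$. Suppose that $L$ admits infinitely many linearly independent Lax flows. Then the support of $L$ is arithmetic, i.e. $\mathrm{supp}(L)=\{N,N-p,\dots,N-mp\}$. Moreover, there exists a unique hierarchy of commuting Lax flows on $\mathcal A$ $$\partial_k(L)=[(L^{qk})_+,L],\qquad k>0.$$ This hierarchy possesses infinitely many conserved densities given by $$h_k=\mathrm{Res}\,L^{qk},\qquad k>0.$$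
   Context: $\mathcal A=\mathbb C[\mathcal S^j(u_i)\mid 1\le i\le M,\ j\in\mathbb Z]$ is the polynomial ring over $\mathbb C$ in the algebraically independent variables $\mathcal S^j(u_i)$, and $\mathcal S$ is the shift automorphism mapping $\mathcal S^j(u_i)$ to $\mathcal S^{j+1}(u_i)$. The algebra of difference operators $\mathcal A[\mathcal S,\mathcal S^{-1}]$ (Laurent polynomials in $\mathcal S$ with coefficients in $\mathcal A$ written on the left) has the product $a\mathcal S^n\,b\mathcal S^{m}=a\,\mathcal S^n(b)\,\mathcal S^{n+m}$. For $P=\sum_n a_n\mathcal S^n$, $\mathrm{supp}(P)=\{n:a_n\neq0\}$, $P_+=\sum_{n\ge0}a_n\mathcal S^n$ and $\mathrm{Res}\,P=a_0$. A Lax flow is a derivation $\partial$ of $\mathcal A$ commuting with $\mathcal S$ whose action on the generators $u_i$ is given by $\partial(L)=[A,L]$, with $\partial(L)=\sum_i\partial(u_i)\mathcal S^{N_i}$, where the auxiliary operator $A\in\mathcal A[\mathcal S,\mathcal S^{-1}]$ is such that $\mathrm{supp}([A,L])\subset\mathrm{supp}(L)$. That the $h_{k}$ are conserved densities of the hierarchy means that $\partial_k(h_{k'})$ lies in the image of $\mathcal S-1:\mathcal A\to\mathcal A$ for all $k,k'>0$. *)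

theory Defs
  imports
    Complex_Main
    "HOL-Library.Poly_Mapping"
    "HOL-Library.Function_Algebras"
    "HOL-Library.FuncSet"
begin

section \<open>Difference polynomials\<close>

text \<open>
  A finite type \<open>'m\<close> plays the role of the index set \<open>{1..M}\<close> of the generators, so
  \<open>M = CARD('m)\<close>. The variable \<open>(i, j)\<close> stands for the \<open>j\<close>-th shift of the generator with index
  \<open>i\<close>; a monomial is an exponent vector, and the product of the type below is the
  (commutative) convolution product of \<^theory>\<open>HOL-Library.Poly_Mapping\<close>.
\<close>

type_synonym 'm dmonom = "('m \<times> int) \<Rightarrow>\<^sub>0 nat"
type_synonym 'm dpoly = "'m dmonom \<Rightarrow>\<^sub>0 complex"

definition Const :: "complex \<Rightarrow> 'm dpoly" where
  "Const c = Poly_Mapping.single 0 c"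

definition var :: "'m \<Rightarrow> int \<Rightarrow> 'm dpoly" where
  "var i j = Poly_Mapping.single (Poly_Mapping.single (i, j) 1) 1"

abbreviation gen :: "'m \<Rightarrow> 'm dpoly" where
  "gen i \<equiv> var i 0"

definition mshift :: "int \<Rightarrow> 'm dmonom \<Rightarrow> 'm dmonom" where
  "mshift n = Poly_Mapping.map_key (\<lambda>(i, j). (i, j - n))"

text \<open>
  \<open>shift n\<close> is the \<open>n\<close>-th power of the shift automorphism. Since \<open>map_key\<close> is contravariant, the
  coefficient of a monomial in \<open>shift n f\<close> is read off at the monomial shifted by \<open>- n\<close>;
  \<open>shift_single\<close> and \<open>shift_var\<close> below state the covariant form.
\<close>

definition shift :: "int \<Rightarrow> 'm dpoly \<Rightarrow> 'm dpoly" where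
  "shift n = Poly_Mapping.map_key (mshift (- n))"

lemma inj_index_shift: "inj (\<lambda>(i, j). (i, j - n :: int))"
  by (auto simp: inj_def)

lemma lookup_mshift: "Poly_Mapping.lookup (mshift n m) (i, j) = Poly_Mapping.lookup m (i, j - n)"
  by (simp add: mshift_def map_key.rep_eq[OF inj_index_shift])

lemma mshift_mshift: "mshift a (mshift b m) = mshift (a + b) m"
  by (rule poly_mapping_eqI) (auto simp: lookup_mshift algebra_simps)

lemma mshift_0 [simp]: "mshift 0 m = m"
  by (rule poly_mapping_eqI) (auto simp: lookup_mshift)

lemma mshift_zero [simp]: "mshift n 0 = 0"
  by (rule poly_mapping_eqI) (auto simp: lookup_mshift)

lemma mshift_add: "mshift n (m + m') = mshift n m + mshift n m'"
  by (rule poly_mapping_eqI) (auto simp: lookup_mshift lookup_add)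

lemma mshift_single: "mshift n (Poly_Mapping.single (i, j) c) = Poly_Mapping.single (i, j + n) c"
  by (rule poly_mapping_eqI) (auto simp: lookup_mshift lookup_single when_def split: if_splits)

lemma inj_mshift: "inj (mshift n)"
  by (rule inj_on_inverseI[where g = "mshift (- n)"]) (simp add: mshift_mshift)

lemma lookup_shift: "Poly_Mapping.lookup (shift n f) m = Poly_Mapping.lookup f (mshift (- n) m)"
  by (simp add: shift_def map_key.rep_eq[OF inj_mshift])

lemma shift_zero [simp]: "shift n 0 = 0"
  by (rule poly_mapping_eqI) (auto simp: lookup_shift)

lemma shift_add: "shift n (f + g) = shift n f + shift n g"
  by (rule poly_mapping_eqI) (auto simp: lookup_shift lookup_add)

lemma shift_single: "shift n (Poly_Mapping.single m c) = Poly_Mapping.single (mshift n m) c"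
proof (rule poly_mapping_eqI)
  fix k
  have "m = mshift (- n) k \<longleftrightarrow> mshift n m = k"
    by (metis add.right_inverse add.left_inverse mshift_0 mshift_mshift)
  then show "Poly_Mapping.lookup (shift n (Poly_Mapping.single m c)) k =
      Poly_Mapping.lookup (Poly_Mapping.single (mshift n m) c) k"
    by (simp add: lookup_shift lookup_single when_def)
qed

lemma shift_var: "shift n (var i j) = var i (j + n)"
  by (simp add: var_def shift_single mshift_single)

lemma shift_Const: "shift n (Const c) = Const c"
  by (simp add: Const_def shift_single)

lemma shift_one [simp]: "shift n 1 = 1"
  using shift_Const[of n 1] by (simp add: Const_def)

lemma shift_0 [simp]: "shift 0 f = f"
  by (rule poly_mapping_eqI) (simp add: lookup_shift)

lemma shift_shift: "shift a (shift b f) = shift (a + b) f"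
  by (rule poly_mapping_eqI) (simp add: lookup_shift mshift_mshift algebra_simps)

lemma poly_mapping_add_induct [case_names zero single add]:
  fixes f :: "'a \<Rightarrow>\<^sub>0 'b::comm_monoid_add"
  assumes "P 0" "\<And>k c. P (Poly_Mapping.single k c)" "\<And>f g. P f \<Longrightarrow> P g \<Longrightarrow> P (f + g)"
  shows "P f"
proof -
  have "P (\<Sum>k\<in>K. Poly_Mapping.single k (Poly_Mapping.lookup f k))" if "finite K" for K
    using that by induction (auto intro: assms)
  moreover have "f = (\<Sum>k\<in>Poly_Mapping.keys f. Poly_Mapping.single k (Poly_Mapping.lookup f k))"
  proof (rule poly_mapping_eqI)
    fix l
    show "Poly_Mapping.lookup f l = Poly_Mapping.lookup
        (\<Sum>k\<in>Poly_Mapping.keys f. Poly_Mapping.single k (Poly_Mapping.lookup f k)) l"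
      by (auto simp: lookup_sum lookup_single when_def in_keys_iff sum.delta)
  qed
  ultimately show ?thesis by (metis finite_keys)
qed

lemma shift_mult: "shift n (f * g) = shift n f * shift n g"
proof (induction f rule: poly_mapping_add_induct)
  case (single k c)
  show ?case
    by (induction g rule: poly_mapping_add_induct)
      (simp_all add: mult_single shift_single mshift_add shift_add distrib_left)
qed (simp_all add: shift_add distrib_right)

definition derivation :: "('m dpoly \<Rightarrow> 'm dpoly) \<Rightarrow> bool" where
  "derivation \<delta> \<longleftrightarrow>
     (\<forall>f g. \<delta> (f + g) = \<delta> f + \<delta> g) \<and>
     (\<forall>c f. \<delta> (Const c * f) = Const c * \<delta> f) \<and>
     (\<forall>f g. \<delta> (f * g) = \<delta> f * g + f * \<delta> g)"

text \<open>Total differences: the image of \<open>\<S> - 1\<close>.\<close>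

definition total_differences :: "'m dpoly set" where
  "total_differences = range (\<lambda>f. shift 1 f - f)"

text \<open>
  The complex vector space of all self-maps of the ring of difference polynomials; it serves
  to express linear independence of flows through the library notion.
\<close>

definition flow_scale :: "complex \<Rightarrow> ('m dpoly \<Rightarrow> 'm dpoly) \<Rightarrow> ('m dpoly \<Rightarrow> 'm dpoly)" where
  "flow_scale c \<delta> = (\<lambda>f. Const c * \<delta> f)"

global_interpretation flows: vector_space flow_scale
proof
  show "flow_scale a (x + y) = flow_scale a x + flow_scale a y" for a and x y :: "'a dpoly \<Rightarrow> 'a dpoly"
    by (simp add: flow_scale_def fun_eq_iff algebra_simps)
  show "flow_scale (a + b) x = flow_scale a x + flow_scale b x" for a b and x :: "'a dpoly \<Rightarrow> 'a dpoly"
    by (simp add: flow_scale_def fun_eq_iff Const_def single_add algebra_simps)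
  show "flow_scale a (flow_scale b x) = flow_scale (a * b) x" for a b and x :: "'a dpoly \<Rightarrow> 'a dpoly"
    by (simp add: flow_scale_def fun_eq_iff Const_def mult_single flip: mult.assoc)
  show "flow_scale 1 x = x" for x :: "'a dpoly \<Rightarrow> 'a dpoly"
    by (simp add: flow_scale_def fun_eq_iff Const_def)
qed


section \<open>Difference operators\<close>

text \<open>
  A difference operator is its finitely supported family of left coefficients. A copy of the
  type is made because the convolution product of \<^theory>\<open>HOL-Library.Poly_Mapping\<close> is the
  untwisted one.
\<close>

typedef 'm dop = "UNIV :: (int \<Rightarrow>\<^sub>0 'm dpoly) set"
  by simp

definition twisted_mult :: "(int \<Rightarrow>\<^sub>0 'm dpoly) \<Rightarrow> (int \<Rightarrow>\<^sub>0 'm dpoly) \<Rightarrow> (int \<Rightarrow>\<^sub>0 'm dpoly)" where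
  "twisted_mult P Q =
     (\<Sum>n\<in>Poly_Mapping.keys P. \<Sum>m\<in>Poly_Mapping.keys Q.
        Poly_Mapping.single (n + m) (Poly_Mapping.lookup P n * shift n (Poly_Mapping.lookup Q m)))"

lemma twisted_mult_superset:
  assumes "finite K" "Poly_Mapping.keys P \<subseteq> K" "finite K'" "Poly_Mapping.keys Q \<subseteq> K'"
  shows "twisted_mult P Q = (\<Sum>n\<in>K. \<Sum>m\<in>K'.
    Poly_Mapping.single (n + m) (Poly_Mapping.lookup P n * shift n (Poly_Mapping.lookup Q m)))"
proof -
  have "(\<Sum>m\<in>Poly_Mapping.keys Q.
      Poly_Mapping.single (n + m) (Poly_Mapping.lookup P n * shift n (Poly_Mapping.lookup Q m))) =
    (\<Sum>m\<in>K'.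
      Poly_Mapping.single (n + m) (Poly_Mapping.lookup P n * shift n (Poly_Mapping.lookup Q m)))" for n
    by (rule sum.mono_neutral_left) (use assms in \<open>auto simp: in_keys_iff\<close>)
  then have "twisted_mult P Q = (\<Sum>n\<in>Poly_Mapping.keys P. \<Sum>m\<in>K'.
      Poly_Mapping.single (n + m) (Poly_Mapping.lookup P n * shift n (Poly_Mapping.lookup Q m)))"
    by (simp add: twisted_mult_def)
  also have "\<dots> = (\<Sum>n\<in>K. \<Sum>m\<in>K'.
      Poly_Mapping.single (n + m) (Poly_Mapping.lookup P n * shift n (Poly_Mapping.lookup Q m)))"
    by (rule sum.mono_neutral_left) (use assms in \<open>auto simp: in_keys_iff\<close>)
  finally show ?thesis .
qed

lemma twisted_mult_add_left: "twisted_mult (P + P') Q = twisted_mult P Q + twisted_mult P' Q"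
proof -
  let ?K = "Poly_Mapping.keys P \<union> Poly_Mapping.keys P'" and ?K' = "Poly_Mapping.keys Q"
  have "Poly_Mapping.keys (P + P') \<subseteq> ?K"
    by (rule keys_add)
  then show ?thesis
    by (simp add: twisted_mult_superset[of ?K _ ?K'] lookup_add distrib_right single_add sum.distrib)
qed

lemma twisted_mult_add_right: "twisted_mult P (Q + Q') = twisted_mult P Q + twisted_mult P Q'"
proof -
  let ?K = "Poly_Mapping.keys P" and ?K' = "Poly_Mapping.keys Q \<union> Poly_Mapping.keys Q'"
  have "Poly_Mapping.keys (Q + Q') \<subseteq> ?K'"
    by (rule keys_add)
  then show ?thesis
    by (simp add: twisted_mult_superset[of ?K _ ?K'] lookup_add shift_add distrib_left single_add
        sum.distrib)
qed

lemma twisted_mult_zero [simp]: "twisted_mult 0 Q = 0" "twisted_mult P 0 = 0"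
  by (simp_all add: twisted_mult_def)

lemma twisted_mult_single:
  "twisted_mult (Poly_Mapping.single n a) (Poly_Mapping.single m b) =
     Poly_Mapping.single (n + m) (a * shift n b)"
  by (simp add: twisted_mult_superset[of "{n}" _ "{m}"])

lemma twisted_mult_assoc:
  "twisted_mult (twisted_mult P Q) R = twisted_mult P (twisted_mult Q R)"
proof (induction P rule: poly_mapping_add_induct)
  case P: (single n a)
  show ?case
  proof (induction Q rule: poly_mapping_add_induct)
    case Q: (single m b)
    show ?case
      by (induction R rule: poly_mapping_add_induct)
        (simp_all add: twisted_mult_add_right twisted_mult_single shift_mult shift_shift algebra_simps)
  qed (simp_all add: twisted_mult_add_right twisted_mult_add_left)
qed (simp_all add: twisted_mult_add_left)

lemma twisted_mult_one:
  "twisted_mult (Poly_Mapping.single 0 1) P = P" "twisted_mult P (Poly_Mapping.single 0 1) = P"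
  by (induction P rule: poly_mapping_add_induct;
      simp add: twisted_mult_add_left twisted_mult_add_right twisted_mult_single del: single_one)+

instantiation dop :: (type) ring_1
begin

definition zero_dop :: "'a dop" where
  "0 = Abs_dop 0"

definition one_dop :: "'a dop" where
  "1 = Abs_dop (Poly_Mapping.single 0 1)"

definition plus_dop :: "'a dop \<Rightarrow> 'a dop \<Rightarrow> 'a dop" where
  "P + Q = Abs_dop (Rep_dop P + Rep_dop Q)"

definition minus_dop :: "'a dop \<Rightarrow> 'a dop \<Rightarrow> 'a dop" where
  "P - Q = Abs_dop (Rep_dop P - Rep_dop Q)"

definition uminus_dop :: "'a dop \<Rightarrow> 'a dop" where
  "- P = Abs_dop (- Rep_dop P)"

definition times_dop :: "'a dop \<Rightarrow> 'a dop \<Rightarrow> 'a dop" where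
  "P * Q = Abs_dop (twisted_mult (Rep_dop P) (Rep_dop Q))"

lemmas Rep_dop_simps =
  zero_dop_def one_dop_def plus_dop_def minus_dop_def uminus_dop_def times_dop_def
  Abs_dop_inverse[OF UNIV_I]

instance
proof
  show "(0 :: 'a dop) \<noteq> 1"
    by (metis Rep_dop_simps(1,2,7) lookup_single_eq lookup_zero zero_neq_one)
qed (simp_all add: Rep_dop_inject[symmetric] Rep_dop_simps algebra_simps twisted_mult_assoc
      twisted_mult_one twisted_mult_add_left twisted_mult_add_right del: single_one)

end

definition dcoeff :: "'m dop \<Rightarrow> int \<Rightarrow> 'm dpoly" where
  "dcoeff P = Poly_Mapping.lookup (Rep_dop P)"

text \<open>\<open>dterm a n\<close> is the operator \<open>a \<S>\<^sup>n\<close>.\<close>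

definition dterm :: "'m dpoly \<Rightarrow> int \<Rightarrow> 'm dop" where
  "dterm a n = Abs_dop (Poly_Mapping.single n a)"

definition supp :: "'m dop \<Rightarrow> int set" where
  "supp P = {n. dcoeff P n \<noteq> 0}"

definition plus_part :: "'m dop \<Rightarrow> 'm dop" where
  "plus_part P = (\<Sum>n\<in>{n \<in> supp P. n \<ge> 0}. dterm (dcoeff P n) n)"

definition Res :: "'m dop \<Rightarrow> 'm dpoly" where
  "Res P = dcoeff P 0"

definition commutator :: "'m dop \<Rightarrow> 'm dop \<Rightarrow> 'm dop" where
  "commutator P Q = P * Q - Q * P"

lemma dterm_mult: "dterm a n * dterm b m = dterm (a * shift n b) (n + m)"
  by (simp add: dterm_def Rep_dop_simps twisted_mult_single)

lemma dterm_one_0: "dterm 1 0 = 1"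
  by (simp add: dterm_def one_dop_def)

lemma dop_eqI: "(\<And>n. dcoeff P n = dcoeff Q n) \<Longrightarrow> P = Q"
  unfolding dcoeff_def by (metis Rep_dop_inject poly_mapping_eqI)

lemma dcoeff_zero [simp]: "dcoeff 0 n = 0"
  by (simp add: dcoeff_def Rep_dop_simps)

lemma dcoeff_add: "dcoeff (P + Q) n = dcoeff P n + dcoeff Q n"
  by (simp add: dcoeff_def Rep_dop_simps lookup_add)

lemma dcoeff_sum: "dcoeff (\<Sum>x\<in>X. P x) n = (\<Sum>x\<in>X. dcoeff (P x) n)"
  by (induction X rule: infinite_finite_induct) (simp_all add: dcoeff_add)

lemma dcoeff_dterm: "dcoeff (dterm a m) n = (if n = m then a else 0)"
  by (simp add: dcoeff_def dterm_def Rep_dop_simps lookup_single when_def)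

lemma finite_supp: "finite (supp P)"
  by (simp add: supp_def dcoeff_def)

lemma dcoeff_plus_part: "dcoeff (plus_part P) n = (if n \<ge> 0 then dcoeff P n else 0)"
  by (simp add: plus_part_def dcoeff_sum dcoeff_dterm finite_supp sum.delta) (simp add: supp_def)


section \<open>Lax flows\<close>

definition lax_op :: "int \<Rightarrow> ('m::finite \<Rightarrow> int) \<Rightarrow> 'm dop" where
  "lax_op N Ns = dterm 1 N + (\<Sum>i\<in>UNIV. dterm (gen i) (Ns i))"

definition lax_deriv :: "('m::finite \<Rightarrow> int) \<Rightarrow> ('m dpoly \<Rightarrow> 'm dpoly) \<Rightarrow> 'm dop" where
  "lax_deriv Ns \<delta> = (\<Sum>i\<in>UNIV. dterm (\<delta> (gen i)) (Ns i))"

definition lax_flow_of ::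
  "int \<Rightarrow> ('m::finite \<Rightarrow> int) \<Rightarrow> 'm dop \<Rightarrow> ('m dpoly \<Rightarrow> 'm dpoly) \<Rightarrow> bool" where
  "lax_flow_of N Ns A \<delta> \<longleftrightarrow>
     derivation \<delta> \<and> (\<forall>f. \<delta> (shift 1 f) = shift 1 (\<delta> f)) \<and>
     supp (commutator A (lax_op N Ns)) \<subseteq> supp (lax_op N Ns) \<and>
     lax_deriv Ns \<delta> = commutator A (lax_op N Ns)"

definition lax_flow :: "int \<Rightarrow> ('m::finite \<Rightarrow> int) \<Rightarrow> ('m dpoly \<Rightarrow> 'm dpoly) \<Rightarrow> bool" where
  "lax_flow N Ns \<delta> \<longleftrightarrow> (\<exists>A. lax_flow_of N Ns A \<delta>)"

text \<open>
  Only the flows \<open>\<delta> k\<close> with \<open>k > 0\<close> belong to a hierarchy; \<open>extensional\<close> removes the freedom in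
  the irrelevant value \<open>\<delta> 0\<close>, so that uniqueness can be stated.
\<close>

definition lax_hierarchy ::
  "int \<Rightarrow> ('m::finite \<Rightarrow> int) \<Rightarrow> nat \<Rightarrow> (nat \<Rightarrow> 'm dpoly \<Rightarrow> 'm dpoly) \<Rightarrow> bool" where
  "lax_hierarchy N Ns q \<delta> \<longleftrightarrow>
     \<delta> \<in> extensional {0<..} \<and>
     (\<forall>k>0. lax_flow_of N Ns (plus_part (lax_op N Ns ^ (q * k))) (\<delta> k)) \<and>
     (\<forall>k>0. \<forall>l>0. \<delta> k \<circ> \<delta> l = \<delta> l \<circ> \<delta> k)"

end

theory Submission
  imports Defs "HOL-Library.Multiset"
begin

text \<open>
  Consider the condition on \<open>supp [A, L]\<close> at the extreme orders of an auxiliary operator \<open>A\<close>. If the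
  lowest order is negative, the trailing coefficient is that of a multiple of a power of \<open>L\<close>, so modulo
  powers of \<open>L\<close> one may take \<open>A\<close> of nonnegative orders; at the highest order \<open>n \<ge> 0\<close> the leading
  coefficient is a constant. Hence infinitely many independent flows
  give such \<open>A\<close> of arbitrarily high order \<open>n\<close>, the next condition gives \<open>N dvd n\<close>, and
  comparing homogeneous parts of weight \<open>n = r N\<close> shows that \<open>(L\<^sup>r)\<^sub>+\<close> itself defines a flow, with
  \<open>r\<close> arbitrarily large. The monomials of the coefficients of \<open>L\<^sup>r\<close> encode paths with steps in the
  support of \<open>L\<close>, and have nonnegative coefficients. If \<open>t\<close> is a gap of the support in the right
  residue class modulo \<open>p\<close>, the coefficient of \<open>\<S>\<^sup>t\<close> in \<open>[(L\<^sup>r)\<^sub>+, L] = - [(L\<^sup>r)\<^sub>-, L]\<close> is a difference of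
  two such sums, and a path from \<open>0\<close> to \<open>t\<close> staying on one side of \<open>0\<close> occurs in only one of them.
  The hierarchy is then handled by the usual zero curvature argument, and the densities
  \<open>Res L\<^sup>q\<^sup>k\<close> are nonzero for large \<open>k\<close> and have pairwise different weights.
\<close>

section \<open>Coefficients of difference polynomials\<close>

abbreviation coef :: "'m dpoly \<Rightarrow> 'm dmonom \<Rightarrow> complex" where
  "coef \<equiv> Poly_Mapping.lookup"

abbreviation uvar :: "'m \<times> int \<Rightarrow> 'm dmonom" where
  "uvar v \<equiv> Poly_Mapping.single v (Suc 0)"

lemma uvar_eq_iff [simp]: "uvar v = uvar w \<longleftrightarrow> v = w"
  by (metis lookup_single_eq lookup_single_not_eq nat.distinct(1))

lemma coef_mult_single: "coef (f * Poly_Mapping.single m c) (k + m) = coef f k * c"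
  by (induction f rule: poly_mapping_add_induct)
    (auto simp: mult_single lookup_single when_def lookup_add distrib_right)

lemma coef_mult_single_eq_0:
  "(\<And>k'. k \<noteq> k' + m) \<Longrightarrow> coef (f * Poly_Mapping.single m c) k = 0"
  by (induction f rule: poly_mapping_add_induct)
    (auto simp: mult_single lookup_single when_def lookup_add distrib_right)

lemma coef_mult_nonzeroE:
  assumes "coef (f * g) m \<noteq> 0"
  obtains a b where "m = a + b" "coef f a \<noteq> 0" "coef g b \<noteq> 0"
proof -
  have "m \<in> Poly_Mapping.keys (f * g)"
    using assms by (simp add: in_keys_iff)
  then obtain a b where "m = a + b" "a \<in> Poly_Mapping.keys f" "b \<in> Poly_Mapping.keys g"
    using keys_mult[of f g] by blast
  then show thesis using that by (simp add: in_keys_iff)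
qed

lemma var_eq: "var i j = Poly_Mapping.single (uvar (i, j)) 1"
  by (simp add: var_def)

lemma coef_mult_var: "coef (f * var i j) (k + uvar (i, j)) = coef f k"
  by (simp add: var_eq coef_mult_single)

lemma uvar_decompose:
  assumes "Poly_Mapping.lookup (m :: 'm dmonom) v \<noteq> 0"
  obtains m' where "m = m' + uvar v"
proof
  show "m = (m - uvar v) + uvar v"
    using assms by (intro poly_mapping_eqI) (auto simp: lookup_add lookup_minus lookup_single when_def)
qed

lemma coef_mult_var_eq_0:
  "Poly_Mapping.lookup m (i, j) = 0 \<Longrightarrow> coef (f * var i j) m = 0"
  unfolding var_eq by (rule coef_mult_single_eq_0) (auto simp: lookup_add)

lemma shift_minus: "shift n (f - g) = shift n f - shift n g"
  by (rule poly_mapping_eqI) (simp add: lookup_shift lookup_minus)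

lemma shift_uminus: "shift n (- f) = - shift n f"
  by (rule poly_mapping_eqI) (simp add: lookup_shift)

lemma shift_sum: "shift n (\<Sum>x\<in>X. f x) = (\<Sum>x\<in>X. shift n (f x))"
  by (induction X rule: infinite_finite_induct) (simp_all add: shift_add)

lemma coef_shift_mshift: "coef (shift n f) (mshift n m) = coef f m"
  by (simp add: lookup_shift mshift_mshift)

lemma Const_mult: "Const a * Const b = Const (a * b)"
  by (simp add: Const_def mult_single)

lemma Const_0 [simp]: "Const 0 = 0" and Const_1 [simp]: "Const 1 = 1"
  by (simp_all add: Const_def)

lemma Const_mult_eq_0:
  assumes "Const c * f = 0" "c \<noteq> 0"
  shows "f = 0"
proof -
  have "Const (1 / c) * (Const c * f) = f"
    using assms(2) by (simp add: Const_mult flip: mult.assoc)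
  then show ?thesis using assms(1) by simp
qed

text \<open>Among the monomials of a nonconstant \<open>f\<close>, one attains the largest shift
  index. A positive shift fixing \<open>f\<close> moves it to a monomial of \<open>f\<close> beyond
  that maximum.\<close>

lemma shift_invariant_imp_Const:
  assumes "shift n f = f" "n \<noteq> 0"
  shows "f = Const (coef f 0)"
proof -
  define X where "X = (\<Union>m\<in>Poly_Mapping.keys f. snd ` Poly_Mapping.keys m)"
  have fin: "finite X"
    by (simp add: X_def)
  \<comment> \<open>Invariance under the inverse shift allows replacing \<open>n\<close> by its
    absolute value, so that indices increase.\<close>
  have "shift (- n) f = f"
    using arg_cong[OF assms(1), of "shift (- n)"] by (simp add: shift_shift)
  then have inv: "shift \<bar>n\<bar> f = f"
    using assms(1) by (simp add: abs_if)
  have "m = 0" if m: "coef f m \<noteq> 0" for m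
  proof (rule ccontr)
    assume "m \<noteq> 0"
    then obtain v where "Poly_Mapping.lookup m v \<noteq> 0"
      by (metis lookup_zero poly_mapping_eqI)
    then have "snd v \<in> X"
      using m unfolding X_def by (metis UN_I image_eqI in_keys_iff)
    then have "Max X \<in> X"
      using Max_in[OF fin] by blast
    then obtain a w where a: "a \<in> Poly_Mapping.keys f" "w \<in> Poly_Mapping.keys a" "snd w = Max X"
      unfolding X_def by (smt (verit) UN_E image_iff)
    have "coef f (mshift \<bar>n\<bar> a) \<noteq> 0"
      using a(1) coef_shift_mshift[of "\<bar>n\<bar>" f a] by (simp add: inv in_keys_iff)
    moreover have "Poly_Mapping.lookup (mshift \<bar>n\<bar> a) (fst w, Max X + \<bar>n\<bar>) \<noteq> 0"
      using a(2,3) by (metis add_diff_cancel_right' in_keys_iff lookup_mshift prod.collapse)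
    ultimately have "Max X + \<bar>n\<bar> \<in> X"
      unfolding X_def by (metis UN_I image_eqI in_keys_iff snd_conv)
    then show False
      using Max_ge[OF fin] assms(2) by fastforce
  qed
  then show ?thesis
    by (intro poly_mapping_eqI) (auto simp: Const_def lookup_single when_def)
qed


section \<open>Weights\<close>

text \<open>All shifts of a generator carry the same weight, which makes the weight shift
  invariant.\<close>

definition mweight :: "('m \<Rightarrow> int) \<Rightarrow> 'm dmonom \<Rightarrow> int" where
  "mweight d m = (\<Sum>v\<in>Poly_Mapping.keys m. int (Poly_Mapping.lookup m v) * d (fst v))"

lemma mweight_superset:
  assumes "finite K" "Poly_Mapping.keys m \<subseteq> K"
  shows "mweight d m = (\<Sum>v\<in>K. int (Poly_Mapping.lookup m v) * d (fst v))"
  unfolding mweight_def by (rule sum.mono_neutral_left) (use assms in \<open>auto simp: in_keys_iff\<close>)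

lemma mweight_add: "mweight d (m + m') = mweight d m + mweight d m'"
proof -
  let ?K = "Poly_Mapping.keys m \<union> Poly_Mapping.keys m'"
  have "Poly_Mapping.keys (m + m') \<subseteq> ?K"
    by (rule keys_add)
  then show ?thesis
    by (simp add: mweight_superset[of ?K] lookup_add distrib_right sum.distrib)
qed

lemma mweight_zero [simp]: "mweight d 0 = 0"
  by (simp add: mweight_def)

lemma mweight_single: "mweight d (Poly_Mapping.single v n) = int n * d (fst v)"
  by (simp add: mweight_superset[of "{v}"])

lemma mweight_mshift: "mweight d (mshift n m) = mweight d m"
proof (induction m rule: poly_mapping_add_induct)
  case (single k c)
  show ?case by (cases k) (simp add: mshift_single mweight_single)
qed (simp_all add: mshift_add mweight_add)

definition wpart :: "('m \<Rightarrow> int) \<Rightarrow> int \<Rightarrow> 'm dpoly \<Rightarrow> 'm dpoly" where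
  "wpart d w = Poly_Mapping.mapp (\<lambda>m c. if mweight d m = w then c else 0)"

lemma coef_wpart: "coef (wpart d w f) m = (if mweight d m = w then coef f m else 0)"
  by (simp add: wpart_def mapp.rep_eq when_def in_keys_iff)

lemma wpart_zero [simp]: "wpart d w 0 = 0"
  by (rule poly_mapping_eqI) (simp add: coef_wpart)

lemma wpart_add: "wpart d w (f + g) = wpart d w f + wpart d w g"
  by (rule poly_mapping_eqI) (simp add: coef_wpart lookup_add)

lemma wpart_minus: "wpart d w (f - g) = wpart d w f - wpart d w g"
  by (rule poly_mapping_eqI) (simp add: coef_wpart lookup_minus)

lemma wpart_sum: "wpart d w (\<Sum>x\<in>X. f x) = (\<Sum>x\<in>X. wpart d w (f x))"
  by (induction X rule: infinite_finite_induct) (simp_all add: wpart_add)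

lemma wpart_shift: "wpart d w (shift n f) = shift n (wpart d w f)"
  by (rule poly_mapping_eqI) (simp add: coef_wpart lookup_shift mweight_mshift)

lemma wpart_mult_var: "wpart d w (f * var i j) = wpart d (w - d i) f * var i j"
proof (rule poly_mapping_eqI)
  fix m
  show "coef (wpart d w (f * var i j)) m = coef (wpart d (w - d i) f * var i j) m"
  proof (cases "Poly_Mapping.lookup m (i, j) = 0")
    case True
    then show ?thesis
      by (simp add: coef_wpart coef_mult_var_eq_0)
  next
    case False
    then obtain k where k: "m = k + uvar (i, j)"
      by (rule uvar_decompose)
    show ?thesis
      unfolding k coef_wpart coef_mult_var
      by (auto simp: mweight_add mweight_single)
  qed
qed

lemma wpart_Const: "wpart d w (Const c) = (if w = 0 then Const c else 0)"
  by (rule poly_mapping_eqI) (auto simp: coef_wpart Const_def lookup_single when_def)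


section \<open>Coefficients of difference operators\<close>

lemma dcoeff_minus: "dcoeff (P - Q) n = dcoeff P n - dcoeff Q n"
  by (simp add: dcoeff_def Rep_dop_simps lookup_minus)

lemma dcoeff_uminus: "dcoeff (- P) n = - dcoeff P n"
  by (simp add: dcoeff_def Rep_dop_simps)

lemma dcoeff_one: "dcoeff 1 n = (if n = 0 then 1 else 0)"
  by (simp add: dcoeff_dterm flip: dterm_one_0)

lemma dterm_zero [simp]: "dterm 0 n = 0"
  by (rule dop_eqI) (simp add: dcoeff_dterm)

lemma dop_decompose: "P = (\<Sum>n\<in>supp P. dterm (dcoeff P n) n)"
  by (rule dop_eqI) (simp add: dcoeff_sum dcoeff_dterm finite_supp sum.delta, simp add: supp_def)

lemma dop_induct [case_names zero dterm add]:
  assumes "Q 0" "\<And>a n. Q (dterm a n)" "\<And>P P'. Q P \<Longrightarrow> Q P' \<Longrightarrow> Q (P + P')"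
  shows "Q P"
proof -
  have "Q (\<Sum>n\<in>K. dterm (dcoeff P n) n)" if "finite K" for K
    using that by induction (auto intro: assms)
  then show ?thesis
    using dop_decompose finite_supp by metis
qed

lemma dcoeff_mult_dterm:
  "dcoeff (P * dterm a n) t = dcoeff P (t - n) * shift (t - n) a"
  by (induction P rule: dop_induct)
    (auto simp: dterm_mult dcoeff_dterm distrib_right dcoeff_add)

lemma dcoeff_dterm_mult:
  "dcoeff (dterm a n * P) t = a * shift n (dcoeff P (t - n))"
  by (induction P rule: dop_induct)
    (auto simp: dterm_mult dcoeff_dterm distrib_left dcoeff_add shift_add)

lemma dcoeff_dterm_0_mult: "dcoeff (dterm a 0 * P) t = a * dcoeff P t"
  by (simp add: dcoeff_dterm_mult)

lemma dterm_Const_commute: "dterm (Const c) 0 * P = P * dterm (Const c) 0"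
  by (rule dop_eqI) (simp add: dcoeff_dterm_mult dcoeff_mult_dterm shift_Const mult.commute)

lemma commutator_add_left: "commutator (P + Q) R = commutator P R + commutator Q R"
  and commutator_add_right: "commutator R (P + Q) = commutator R P + commutator R Q"
  and commutator_minus_left: "commutator (P - Q) R = commutator P R - commutator Q R"
  by (simp_all add: commutator_def algebra_simps)

lemma commutator_zero [simp]: "commutator 0 P = 0" "commutator P 0 = 0"
  by (simp_all add: commutator_def)

lemma commutator_Const_mult:
  "commutator (dterm (Const c) 0 * P) Q = dterm (Const c) 0 * commutator P Q"
  using dterm_Const_commute[of c Q]
  by (simp add: commutator_def right_diff_distrib mult.assoc[symmetric])

lemma commutator_power [simp]: "commutator (P ^ r) (P ^ s) = 0" "commutator (P ^ r) P = 0"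
  by (simp_all add: commutator_def power_commutes flip: power_add add: add.commute)

section \<open>Total differences and residues of commutators\<close>

lemma total_differencesI: "f = shift 1 a - a \<Longrightarrow> f \<in> total_differences"
  unfolding total_differences_def by (rule range_eqI)

lemma total_differencesE:
  assumes "f \<in> total_differences"
  obtains a where "f = shift 1 a - a"
  using assms unfolding total_differences_def by blast

lemma total_differences_add:
  assumes "f \<in> total_differences" "g \<in> total_differences"
  shows "f + g \<in> total_differences"
proof -
  obtain a b where "f = shift 1 a - a" "g = shift 1 b - b"
    using assms by (elim total_differencesE)
  then show ?thesis
    by (intro total_differencesI[of _ "a + b"]) (simp add: shift_add)
qed

lemma total_differences_uminus:
  assumes "f \<in> total_differences"
  shows "- f \<in> total_differences"
proof -
  obtain a where "f = shift 1 a - a"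
    using assms by (elim total_differencesE)
  then show ?thesis
    by (intro total_differencesI[of _ "- a"]) (simp add: shift_uminus)
qed

lemma zero_total_differences [simp]: "0 \<in> total_differences"
  by (rule total_differencesI[of _ 0]) simp

text \<open>The difference telescopes for nonnegative \<open>n\<close>; for negative
  \<open>n\<close> it is minus the difference that the shift by \<open>- n\<close> makes on
  \<open>shift n f\<close>.\<close>

lemma shift_diff_total_differences: "shift n f - f \<in> total_differences"
proof -
  have nat: "shift (int k) f - f \<in> total_differences" for k and f :: "'a dpoly"
  proof (induction k)
    case (Suc k)
    have "shift (int (Suc k)) f - f =
        (shift 1 (shift (int k) f) - shift (int k) f) + (shift (int k) f - f)"
      by (simp add: shift_shift)
    then show ?case
      using total_differences_add[OF total_differencesI[OF refl] Suc] by (simp only:)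
  qed simp
  show ?thesis
  proof (cases "n \<ge> 0")
    case True
    then show ?thesis using nat[of "nat n" f] by simp
  next
    case False
    then show ?thesis
      using total_differences_uminus[OF nat[of "nat (- n)" "shift n f"]] by (simp add: shift_shift)
  qed
qed

text \<open>Bilinearity reduces this to two terms of opposite orders \<open>n\<close> and
  \<open>m\<close>, where the residue is \<open>shift n g - g\<close> with
  \<open>g = b * shift m a\<close>.\<close>

lemma Res_commutator_total_differences: "Res (commutator P Q) \<in> total_differences"
proof (induction P rule: dop_induct)
  case (dterm a n)
  show ?case
  proof (induction Q rule: dop_induct)
    case (dterm b m)
    have "Res (commutator (dterm a n) (dterm b m)) =
        (if n + m = 0 then shift n (b * shift m a) - b * shift m a else 0)"
      by (auto simp: Res_def commutator_def dterm_mult dcoeff_minus dcoeff_dterm shift_mult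
          shift_shift add.commute)
    then show ?case
      using shift_diff_total_differences[of n "b * shift m a"] by simp
  next
    case (add P P')
    then show ?case
      by (simp add: commutator_add_right Res_def dcoeff_add total_differences_add)
  qed (simp add: Res_def)
next
  case (add P P')
  then show ?case
    by (simp add: commutator_add_left Res_def dcoeff_add total_differences_add)
qed (simp add: Res_def)

section \<open>Derivations\<close>

text \<open>Induction over ring generators; it extends identities between derivations from variables
  to all polynomials.\<close>

lemma dpoly_induct [case_names Const var add mult]:
  assumes Const: "\<And>c. P (Const c)" and var: "\<And>i j. P (var i j)"
    and add: "\<And>f g. P f \<Longrightarrow> P g \<Longrightarrow> P (f + g)" and mult: "\<And>f g. P f \<Longrightarrow> P g \<Longrightarrow> P (f * g)"
  shows "P f"
proof -
  have mono: "P (Poly_Mapping.single m 1)" for m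
  proof (induction m rule: poly_mapping_add_induct)
    case zero
    show ?case using Const[of 1] by (simp add: Const_def)
  next
    case (single k n)
    show ?case
    proof (induction n)
      case 0
      show ?case using Const[of 1] by (simp add: Const_def)
    next
      case (Suc n)
      obtain i j where "k = (i, j)" by (cases k)
      then have "Poly_Mapping.single (Poly_Mapping.single k (Suc n)) 1 =
          Poly_Mapping.single (Poly_Mapping.single k n) 1 * var i j"
        by (simp add: var_def mult_single flip: single_add)
      then show ?case using Suc var mult by metis
    qed
  next
    case (add m m')
    then show ?case
      using mult[of "Poly_Mapping.single m 1" "Poly_Mapping.single m' 1"] by (simp add: mult_single)
  qed
  have single: "P (Poly_Mapping.single m c)" for m c
    using mult[OF Const[of c] mono[of m]] by (simp add: Const_def mult_single)
  show ?thesis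
  proof (induction f rule: poly_mapping_add_induct)
    case zero
    show ?case using Const[of 0] by simp
  qed (use single add in auto)
qed

locale shift_derivation =
  fixes \<delta> :: "'m dpoly \<Rightarrow> 'm dpoly"
  assumes derivation: "derivation \<delta>"
    and shift_1: "\<delta> (shift 1 f) = shift 1 (\<delta> f)"
begin

lemma add: "\<delta> (f + g) = \<delta> f + \<delta> g"
  and scale: "\<delta> (Const c * f) = Const c * \<delta> f"
  and mult: "\<delta> (f * g) = \<delta> f * g + f * \<delta> g"
  using derivation unfolding derivation_def by blast+

lemma zero [simp]: "\<delta> 0 = 0"
  using add[of 0 0] by simp

lemma one [simp]: "\<delta> 1 = 0"
  using mult[of 1 1] by simp

lemma Const [simp]: "\<delta> (Const c) = 0"
  using scale[of c 1] by simp

lemma diff: "\<delta> (f - g) = \<delta> f - \<delta> g"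
  using add[of "f - g" g] by (simp add: algebra_simps)

lemma shift: "\<delta> (shift n f) = shift n (\<delta> f)"
proof -
  have nat: "\<delta> (shift (int k) f) = shift (int k) (\<delta> f)" for k f
    by (induction k) (simp_all add: shift_1 flip: shift_shift)
  show ?thesis
  proof (cases "n \<ge> 0")
    case True
    then show ?thesis using nat[of "nat n" f] by simp
  next
    case False
    then have "\<delta> f = shift (- n) (\<delta> (shift n f))"
      using nat[of "nat (- n)" "shift n f"] by (simp add: shift_shift)
    then have "shift n (\<delta> f) = shift n (shift (- n) (\<delta> (shift n f)))"
      by (rule arg_cong)
    then show ?thesis by (simp add: shift_shift)
  qed
qed

lemma var: "\<delta> (var i j) = shift j (\<delta> (gen i))"
  using shift[of j "gen i"] by (simp add: shift_var)

text \<open>The derivation acts on coefficients and treats the shift symbol as a constant. Since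
  \<open>\<delta>\<close> commutes with all shifts, the result is a derivation of the twisted
  product (\<open>lift_mult\<close>).\<close>

definition lift :: "'m dop \<Rightarrow> 'm dop" where
  "lift P = (\<Sum>n\<in>supp P. dterm (\<delta> (dcoeff P n)) n)"

lemma dcoeff_lift: "dcoeff (lift P) n = \<delta> (dcoeff P n)"
  by (simp add: lift_def dcoeff_sum dcoeff_dterm finite_supp sum.delta) (auto simp: supp_def)

lemma lift_zero [simp]: "lift 0 = 0"
  by (rule dop_eqI) (simp add: dcoeff_lift)

lemma lift_one [simp]: "lift 1 = 0"
  by (rule dop_eqI) (simp add: dcoeff_lift dcoeff_one)

lemma lift_add: "lift (P + Q) = lift P + lift Q"
  by (rule dop_eqI) (simp add: dcoeff_lift dcoeff_add add)

lemma lift_diff: "lift (P - Q) = lift P - lift Q"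
  by (rule dop_eqI) (simp add: dcoeff_lift dcoeff_minus diff)

lemma lift_sum: "lift (\<Sum>x\<in>X. P x) = (\<Sum>x\<in>X. lift (P x))"
  by (induction X rule: infinite_finite_induct) (simp_all add: lift_add)

lemma lift_dterm: "lift (dterm a n) = dterm (\<delta> a) n"
  by (rule dop_eqI) (simp add: dcoeff_lift dcoeff_dterm)

lemma lift_plus_part: "lift (plus_part P) = plus_part (lift P)"
  by (rule dop_eqI) (simp add: dcoeff_lift dcoeff_plus_part)

lemma lift_mult: "lift (P * Q) = lift P * Q + P * lift Q"
proof (induction P rule: dop_induct)
  case (dterm a n)
  show ?case
  proof (induction Q rule: dop_induct)
    case (dterm b m)
    show ?case
      by (rule dop_eqI)
        (simp add: lift_dterm dterm_mult dcoeff_dterm dcoeff_add mult shift)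
  qed (simp_all add: lift_add distrib_left)
qed (simp_all add: lift_add distrib_right)

lemma lift_commutator: "lift (commutator P Q) = commutator (lift P) Q + commutator P (lift Q)"
  by (simp add: commutator_def lift_diff lift_mult)

text \<open>Both \<open>lift\<close> and the commutator with \<open>A\<close> satisfy the Leibniz
  rule, so a Lax equation for \<open>P\<close> passes to its powers.\<close>

lemma lift_power:
  assumes "lift P = commutator A P"
  shows "lift (P ^ r) = commutator A (P ^ r)"
proof (induction r)
  case 0
  show ?case by (simp add: commutator_def)
next
  case (Suc r)
  show ?case
    by (simp add: lift_mult assms Suc.IH) (simp add: commutator_def algebra_simps)
qed

end

lemma shift_derivation_eqI:
  assumes "shift_derivation \<delta>" "shift_derivation \<delta>'" "\<And>i. \<delta> (gen i) = \<delta>' (gen i)"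
  shows "\<delta> = \<delta>'"
proof
  fix f
  interpret a: shift_derivation \<delta> by fact
  interpret b: shift_derivation \<delta>' by fact
  show "\<delta> f = \<delta>' f"
  proof (induction f rule: dpoly_induct)
    case (var i j)
    show ?case using assms(3)[of i] by (simp add: a.var[of i j] b.var[of i j])
  qed (simp_all add: a.add b.add a.mult b.mult)
qed

section \<open>Partial derivatives and evolutionary derivations\<close>

definition pderiv_var :: "'m \<times> int \<Rightarrow> 'm dpoly \<Rightarrow> 'm dpoly" where
  "pderiv_var v f = Poly_Mapping.mapp (\<lambda>m c. of_nat (Poly_Mapping.lookup m v + 1) * c)
     (Poly_Mapping.map_key (\<lambda>m. m + uvar v) f)"

lemma coef_pderiv_var:
  "coef (pderiv_var v f) m = of_nat (Poly_Mapping.lookup m v + 1) * coef f (m + uvar v)"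
proof -
  have "inj (\<lambda>m. m + uvar v)"
    by (auto simp: inj_def)
  then show ?thesis
    by (simp add: pderiv_var_def mapp.rep_eq map_key.rep_eq when_def in_keys_iff)
qed

lemma pderiv_var_zero [simp]: "pderiv_var v 0 = 0"
  by (rule poly_mapping_eqI) (simp add: coef_pderiv_var)

lemma pderiv_var_add: "pderiv_var v (f + g) = pderiv_var v f + pderiv_var v g"
  by (rule poly_mapping_eqI) (simp add: coef_pderiv_var lookup_add algebra_simps)

lemma pderiv_var_single_0:
  "Poly_Mapping.lookup m v = 0 \<Longrightarrow> pderiv_var v (Poly_Mapping.single m c) = 0"
  by (rule poly_mapping_eqI) (auto simp: coef_pderiv_var lookup_single when_def lookup_add)

lemma pderiv_var_single_add:
  "pderiv_var v (Poly_Mapping.single (m + uvar v) c) =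
     Poly_Mapping.single m (of_nat (Poly_Mapping.lookup m v + 1) * c)"
  by (rule poly_mapping_eqI) (auto simp: coef_pderiv_var lookup_single when_def lookup_add)

text \<open>The rule is checked on pairs of monomials. Whether each contains \<open>v\<close> is
  distinguished because the derivative of a monomial is described by splitting off one factor
  \<open>v\<close>.\<close>

lemma pderiv_var_mult: "pderiv_var v (f * g) = pderiv_var v f * g + f * pderiv_var v g"
proof (induction f rule: poly_mapping_add_induct)
  case (single m c)
  show ?case
  proof (induction g rule: poly_mapping_add_induct)
    case (single m' c')
    consider "Poly_Mapping.lookup m v = 0" "Poly_Mapping.lookup m' v = 0"
      | k where "m = k + uvar v" "Poly_Mapping.lookup m' v = 0"
      | k' where "Poly_Mapping.lookup m v = 0" "m' = k' + uvar v"
      | k k' where "m = k + uvar v" "m' = k' + uvar v"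
      by (metis uvar_decompose)
    then show ?case
    proof cases
      case 1
      then show ?thesis
        by (simp add: mult_single pderiv_var_single_0 lookup_add)
    next
      case (2 k)
      have "m + m' = (k + m') + uvar v"
        using 2 by (simp add: algebra_simps)
      then show ?thesis
        using 2 pderiv_var_single_add[of v "k + m'" "c * c'"] pderiv_var_single_add[of v k c]
        by (simp add: mult_single pderiv_var_single_0 lookup_add algebra_simps)
    next
      case (3 k')
      have "m + m' = (m + k') + uvar v"
        using 3 by (simp add: algebra_simps)
      then show ?thesis
        using 3 pderiv_var_single_add[of v "m + k'" "c * c'"] pderiv_var_single_add[of v k' c']
        by (simp add: mult_single pderiv_var_single_0 lookup_add algebra_simps)
    next
      case (4 k k')
      have "m + m' = (k + k' + uvar v) + uvar v"
        using 4 by (simp add: algebra_simps)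
      then show ?thesis
        using 4 pderiv_var_single_add[of v "k + k' + uvar v" "c * c'"]
          pderiv_var_single_add[of v k c] pderiv_var_single_add[of v k' c']
        by (simp add: mult_single lookup_add algebra_simps flip: single_add)
    qed
  qed (simp_all add: pderiv_var_add distrib_left)
qed (simp_all add: pderiv_var_add distrib_right)

lemma pderiv_var_Const [simp]: "pderiv_var v (Const c) = 0"
  by (simp add: Const_def pderiv_var_single_0)

lemma pderiv_var_shift:
  "pderiv_var (i, j) (shift n f) = shift n (pderiv_var (i, j - n) f)"
  by (rule poly_mapping_eqI)
    (simp add: coef_pderiv_var lookup_shift mshift_add mshift_single lookup_mshift)

lemma pderiv_var_var: "pderiv_var v (var i j) = (if v = (i, j) then 1 else 0)"
  using pderiv_var_single_add[of v 0 1] pderiv_var_single_0[of "uvar (i, j)" v 1]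
  by (auto simp: var_def lookup_single when_def)

text \<open>The evolutionary derivation with characteristic \<open>g\<close>.\<close>

definition evol :: "('m \<Rightarrow> 'm dpoly) \<Rightarrow> 'm dpoly \<Rightarrow> 'm dpoly" where
  "evol g f = (\<Sum>v\<in>{v. pderiv_var v f \<noteq> 0}. shift (snd v) (g (fst v)) * pderiv_var v f)"

lemma finite_pderiv_var: "finite {v. pderiv_var v f \<noteq> 0}"
proof (induction f rule: dpoly_induct)
  case (add f g)
  then show ?case
    by (rule rev_finite_subset[OF finite_UnI]) (auto simp: pderiv_var_add)
next
  case (mult f g)
  then show ?case
    by (rule rev_finite_subset[OF finite_UnI]) (auto simp: pderiv_var_mult)
qed (auto simp: pderiv_var_var)

lemma evol_superset:
  assumes "finite K" "\<And>v. pderiv_var v f \<noteq> 0 \<Longrightarrow> v \<in> K"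
  shows "evol g f = (\<Sum>v\<in>K. shift (snd v) (g (fst v)) * pderiv_var v f)"
  unfolding evol_def by (rule sum.mono_neutral_left) (use assms in auto)

lemma evol_gen: "evol g (gen i) = g i"
  by (subst evol_superset[of "{(i, 0)}"]) (auto simp: pderiv_var_var split: if_splits)

text \<open>Any choice of images of the generators extends to a derivation commuting with the shift;
  this is how an auxiliary operator produces a flow.\<close>

lemma shift_derivation_evol: "shift_derivation (evol (g :: 'm \<Rightarrow> 'm dpoly))"
proof
  let ?V = "\<lambda>f :: 'm dpoly. {v. pderiv_var v f \<noteq> 0}"
  let ?E = "\<lambda>(f :: 'm dpoly) K. \<Sum>v\<in>K. shift (snd v) (g (fst v)) * pderiv_var v f"
  show "derivation (evol g)"
    unfolding derivation_def
  proof (intro conjI allI)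
    fix a b :: "'m dpoly"
    have fin: "finite (?V a \<union> ?V b)"
      by (simp add: finite_pderiv_var)
    have "evol g (a + b) = ?E (a + b) (?V a \<union> ?V b)" "evol g a = ?E a (?V a \<union> ?V b)"
      "evol g b = ?E b (?V a \<union> ?V b)" "evol g (a * b) = ?E (a * b) (?V a \<union> ?V b)"
      by (rule evol_superset[OF fin]; auto simp: pderiv_var_add pderiv_var_mult)+
    then show "evol g (a + b) = evol g a + evol g b"
      and "evol g (a * b) = evol g a * b + a * evol g b"
      by (simp_all add: pderiv_var_add pderiv_var_mult algebra_simps sum.distrib sum_distrib_left)
  next
    fix c and a :: "'m dpoly"
    have "evol g (Const c * a) = ?E (Const c * a) (?V a)"
      by (rule evol_superset[OF finite_pderiv_var]) (auto simp: pderiv_var_mult)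
    then show "evol g (Const c * a) = Const c * evol g a"
      by (simp add: evol_def pderiv_var_mult algebra_simps sum_distrib_left)
  qed
next
  fix f :: "'m dpoly"
  \<comment> \<open>The derivative of a shifted polynomial by the variable \<open>s v\<close> is the
    shift of the derivative by \<open>v\<close>, so \<open>s\<close> reindexes one sum into the
    other.\<close>
  define s where "s = (\<lambda>(i :: 'm, j :: int). (i, j + 1))"
  have inj: "inj s"
    by (auto simp: s_def inj_def)
  let ?V = "{v. pderiv_var v f \<noteq> 0}"
  have "evol g (shift 1 f) = (\<Sum>v\<in>s ` ?V. shift (snd v) (g (fst v)) * pderiv_var v (shift 1 f))"
  proof (rule evol_superset)
    fix v assume v: "pderiv_var v (shift 1 f) \<noteq> 0"
    obtain i j where ij: "v = (i, j)" by (cases v)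
    have "s (i, j - 1) = v" "pderiv_var (i, j - 1) f \<noteq> 0"
      using v by (auto simp: ij s_def pderiv_var_shift)
    then show "v \<in> s ` ?V" by blast
  qed (simp add: finite_pderiv_var)
  also have "\<dots> = (\<Sum>v\<in>?V. shift (snd (s v)) (g (fst (s v))) * pderiv_var (s v) (shift 1 f))"
    using inj by (subst sum.reindex) (auto simp: inj_on_def)
  also have "\<dots> = (\<Sum>v\<in>?V. shift 1 (shift (snd v) (g (fst v)) * pderiv_var v f))"
    by (rule sum.cong) (auto simp: s_def pderiv_var_shift shift_mult shift_shift add.commute)
  finally show "evol g (shift 1 f) = shift 1 (evol g f)"
    by (simp add: evol_def shift_sum)
qed

section \<open>Nonnegative parts and supports of products\<close>

lemma dcoeff_mult: "dcoeff (P * Q) n = (\<Sum>a\<in>supp P. dcoeff P a * shift a (dcoeff Q (n - a)))"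
proof -
  have "dcoeff (P * Q) n = dcoeff ((\<Sum>a\<in>supp P. dterm (dcoeff P a) a) * Q) n"
    using dop_decompose[of P] by simp
  also have "\<dots> = (\<Sum>a\<in>supp P. dcoeff P a * shift a (dcoeff Q (n - a)))"
    by (simp add: sum_distrib_right dcoeff_sum dcoeff_dterm_mult)
  finally show ?thesis .
qed

lemma dcoeff_mult_nonzeroE:
  assumes "dcoeff (P * Q) n \<noteq> 0"
  obtains a where "dcoeff P a \<noteq> 0" "dcoeff Q (n - a) \<noteq> 0"
proof -
  obtain a where "dcoeff P a * shift a (dcoeff Q (n - a)) \<noteq> 0"
    using assms unfolding dcoeff_mult by (metis (no_types, lifting) sum.neutral)
  then show thesis using that[of a] by (metis mult_zero_left mult_zero_right shift_zero)
qed

lemma plus_part_add: "plus_part (P + Q) = plus_part P + plus_part Q"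
  by (rule dop_eqI) (simp add: dcoeff_plus_part dcoeff_add)

lemma plus_part_minus: "plus_part (P - Q) = plus_part P - plus_part Q"
  by (rule dop_eqI) (simp add: dcoeff_plus_part dcoeff_minus)

lemma plus_part_nonneg: "(\<And>n. n < 0 \<Longrightarrow> dcoeff P n = 0) \<Longrightarrow> plus_part P = P"
  by (rule dop_eqI) (simp add: dcoeff_plus_part)

lemma plus_part_neg: "(\<And>n. n \<ge> 0 \<Longrightarrow> dcoeff P n = 0) \<Longrightarrow> plus_part P = 0"
  by (rule dop_eqI) (simp add: dcoeff_plus_part)

lemma plus_part_mult_plus_part: "plus_part (plus_part P * plus_part Q) = plus_part P * plus_part Q"
  by (rule plus_part_nonneg, rule ccontr)
    (auto simp: dcoeff_plus_part elim!: dcoeff_mult_nonzeroE split: if_splits)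

definition minus_part :: "'m dop \<Rightarrow> 'm dop" where
  "minus_part P = P - plus_part P"

lemma dcoeff_minus_part: "dcoeff (minus_part P) n = (if n < 0 then dcoeff P n else 0)"
  by (simp add: minus_part_def dcoeff_minus dcoeff_plus_part)

lemma plus_part_mult_minus_part: "plus_part (minus_part P * minus_part Q) = 0"
  by (rule plus_part_neg, rule ccontr)
    (auto simp: dcoeff_minus_part elim!: dcoeff_mult_nonzeroE split: if_splits)

text \<open>Split \<open>R\<close> and \<open>T\<close> into nonnegative and negative orders and
  take the nonnegative part of \<open>commutator R T = 0\<close>: the commutator of the two negative
  parts disappears, that of the two nonnegative parts is unchanged.\<close>

lemma zero_curvature_plus_part:
  assumes "commutator R T = 0"
  shows "plus_part (commutator (plus_part R) T) - plus_part (commutator (plus_part T) R)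
    = commutator (plus_part R) (plus_part T)"
proof -
  let ?P = "plus_part" and ?M = "minus_part"
  have dec: "P = ?P P + ?M P" for P :: "'a dop"
    by (simp add: minus_part_def)
  have PP: "?P (commutator (?P R) (?P T)) = commutator (?P R) (?P T)" for R T :: "'a dop"
    by (simp add: commutator_def plus_part_minus plus_part_mult_plus_part)
  have MM: "?P (commutator (?M R) (?M T)) = 0"
    by (simp add: commutator_def plus_part_minus plus_part_mult_minus_part)
  have RT: "commutator (?P R) T = commutator (?P R) (?P T) + commutator (?P R) (?M T)"
    using dec[of T] by (metis commutator_add_right)
  have TR: "commutator (?P T) R = commutator (?P T) (?P R) + commutator (?P T) (?M R)"
    using dec[of R] by (metis commutator_add_right)
  have anti: "commutator P Q = - commutator Q P" for P Q :: "'a dop"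
    by (simp add: commutator_def)
  have "0 = ?P (commutator R T)"
    using assms by (simp add: plus_part_neg)
  also have "commutator R T = commutator (?P R + ?M R) (?P T + ?M T)"
    using dec by metis
  also have "\<dots> = commutator (?P R) T + (commutator (?M R) (?P T) + commutator (?M R) (?M T))"
    by (simp add: RT commutator_add_left commutator_add_right)
  also have "commutator (?M R) (?P T) = commutator (?P T) (?P R) - commutator (?P T) R"
    unfolding TR using anti[of "?M R" "?P T"] by simp
  finally have "?P (commutator (?P R) T) + (commutator (?P T) (?P R) - ?P (commutator (?P T) R)) = 0"
    by (simp add: plus_part_add plus_part_minus PP MM)
  then have "?P (commutator (?P T) R) = ?P (commutator (?P R) T) + commutator (?P T) (?P R)"
    by (metis add_diff_eq right_minus_eq)
  then show ?thesis
    using anti[of "?P R" "?P T"] by simp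
qed

lemma jacobi: "commutator (commutator P Q) R = commutator P (commutator Q R) - commutator Q (commutator P R)"
  by (simp add: commutator_def algebra_simps)


section \<open>Lax flows as admissible operators\<close>

locale lax_operator =
  fixes N :: int and Ns :: "'m::{finite,linorder} \<Rightarrow> int"
  assumes N_pos: "N > 0"
    and Ns_less: "Ns i < N"
    and Ns_antimono: "i < j \<Longrightarrow> Ns i > Ns j"
    and Ns_Max_neg: "Ns (Max UNIV) < 0"
begin

definition L :: "'m dop" where
  "L = lax_op N Ns"

definition lead :: 'm where
  "lead = Min UNIV"

definition trail :: 'm where
  "trail = Max UNIV"

text \<open>The letter \<open>None\<close> stands for the leading term \<open>\<S>\<^sup>N\<close> of \<open>L\<close>.\<close>

fun expo :: "'m option \<Rightarrow> int" where
  "expo None = N"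
| "expo (Some i) = Ns i"

fun factor :: "'m option \<Rightarrow> 'm dpoly" where
  "factor None = 1"
| "factor (Some i) = gen i"

lemma Ns_trail_neg: "Ns trail < 0"
  using Ns_Max_neg by (simp add: trail_def)

lemma Ns_le_lead: "Ns i \<le> Ns lead"
proof (cases "i = lead")
  case False
  then have "lead < i"
    unfolding lead_def using Min_le[OF finite, of i UNIV] by (metis UNIV_I order_le_less)
  then show ?thesis using Ns_antimono by fastforce
qed simp

lemma Ns_ge_trail: "Ns trail \<le> Ns i"
proof (cases "i = trail")
  case False
  then have "i < trail"
    unfolding trail_def using Max_ge[OF finite, of i UNIV] by (metis UNIV_I order_le_less)
  then show ?thesis using Ns_antimono by fastforce
qed simp

lemma Ns_eq_iff [simp]: "Ns i = Ns j \<longleftrightarrow> i = j"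
  by (metis Ns_antimono less_irrefl linorder_less_linear)

lemma Ns_neq_N [simp]: "Ns i \<noteq> N" "N \<noteq> Ns i"
  using Ns_less[of i] by auto

lemma expo_eq_iff [simp]: "expo x = expo y \<longleftrightarrow> x = y"
  by (cases x; cases y) auto

lemma expo_le: "expo x \<le> N"
  using Ns_less by (cases x) (auto simp: order.strict_implies_order)

lemma expo_ge: "Ns trail \<le> expo x"
  using Ns_ge_trail Ns_trail_neg N_pos by (cases x) auto

lemma gen_nonzero [simp]: "gen i \<noteq> 0"
  by (metis lookup_single_eq lookup_zero one_neq_zero var_def)

lemma factor_nonzero [simp]: "factor x \<noteq> 0"
  by (cases x) auto

lemma L_eq: "L = (\<Sum>x\<in>UNIV. dterm (factor x) (expo x))"
  by (simp add: L_def lax_op_def UNIV_option_conv sum.reindex)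

lemma dcoeff_L_expo: "dcoeff L (expo x) = factor x"
  by (simp add: L_eq dcoeff_sum dcoeff_dterm)

lemma dcoeff_L_eq_0: "t \<notin> range expo \<Longrightarrow> dcoeff L t = 0"
  by (auto simp: L_eq dcoeff_sum dcoeff_dterm intro!: sum.neutral)

lemma range_expo: "range expo = insert N (range Ns)"
  by (auto simp: UNIV_option_conv image_image)

lemma supp_L: "supp L = insert N (range Ns)"
proof -
  have "t \<in> supp L \<longleftrightarrow> t \<in> range expo" for t
    using dcoeff_L_eq_0[of t] by (auto simp: supp_def dcoeff_L_expo)
  then show ?thesis using range_expo by auto
qed

lemma dcoeff_mult_L:
  "dcoeff (A * L) t = (\<Sum>x\<in>UNIV. dcoeff A (t - expo x) * shift (t - expo x) (factor x))"
  by (simp add: L_eq sum_distrib_left dcoeff_sum dcoeff_mult_dterm)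

lemma dcoeff_L_mult:
  "dcoeff (L * A) t = (\<Sum>x\<in>UNIV. factor x * shift (expo x) (dcoeff A (t - expo x)))"
  by (simp add: L_eq sum_distrib_right dcoeff_sum dcoeff_dterm_mult)

lemma dcoeff_commutator_L:
  "dcoeff (commutator A L) t = (\<Sum>x\<in>UNIV. dcoeff A (t - expo x) * shift (t - expo x) (factor x) -
     factor x * shift (expo x) (dcoeff A (t - expo x)))"
  by (simp add: commutator_def dcoeff_minus dcoeff_mult_L dcoeff_L_mult sum_subtractf)

text \<open>The order \<open>N\<close> is forbidden as well, although it lies in the support of
  \<open>L\<close>: the leading coefficient 1 is killed by every derivation.\<close>

definition admissible :: "'m dop \<Rightarrow> bool" where
  "admissible A \<longleftrightarrow> (\<forall>t. t \<notin> range Ns \<longrightarrow> dcoeff (commutator A L) t = 0)"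

lemma dcoeff_lax_deriv: "dcoeff (lax_deriv Ns \<delta>) (Ns i) = \<delta> (gen i)"
  by (simp add: lax_deriv_def dcoeff_sum dcoeff_dterm)

lemma dcoeff_lax_deriv_eq_0: "t \<notin> range Ns \<Longrightarrow> dcoeff (lax_deriv Ns \<delta>) t = 0"
  by (auto simp: lax_deriv_def dcoeff_sum dcoeff_dterm intro!: sum.neutral)

text \<open>Separates the condition on the operator from the one on the derivation: the Lax equation
  only prescribes the images of the generators, which can always be realised.\<close>

lemma lax_flow_of_iff:
  "lax_flow_of N Ns A \<delta> \<longleftrightarrow> shift_derivation \<delta> \<and> admissible A \<and>
     (\<forall>i. \<delta> (gen i) = dcoeff (commutator A L) (Ns i))"
proof
  assume flow: "lax_flow_of N Ns A \<delta>"
  then have eq: "lax_deriv Ns \<delta> = commutator A L"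
    by (simp add: lax_flow_of_def L_def)
  have "shift_derivation \<delta>"
    using flow by (simp add: shift_derivation_def lax_flow_of_def)
  then show "shift_derivation \<delta> \<and> admissible A \<and>
     (\<forall>i. \<delta> (gen i) = dcoeff (commutator A L) (Ns i))"
    unfolding admissible_def eq[symmetric]
    by (simp add: dcoeff_lax_deriv dcoeff_lax_deriv_eq_0)
next
  assume r: "shift_derivation \<delta> \<and> admissible A \<and>
     (\<forall>i. \<delta> (gen i) = dcoeff (commutator A L) (Ns i))"
  have "lax_deriv Ns \<delta> = commutator A L"
  proof (rule dop_eqI)
    fix t
    show "dcoeff (lax_deriv Ns \<delta>) t = dcoeff (commutator A L) t"
      using r by (cases "t \<in> range Ns")
        (auto simp: dcoeff_lax_deriv dcoeff_lax_deriv_eq_0 admissible_def)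
  qed
  moreover have "supp (commutator A L) \<subseteq> supp L"
    using r unfolding supp_L by (auto simp: supp_def admissible_def)
  ultimately show "lax_flow_of N Ns A \<delta>"
    using r by (simp add: lax_flow_of_def L_def shift_derivation_def)
qed

lemma lift_L:
  assumes "lax_flow_of N Ns A \<delta>"
  shows "shift_derivation.lift \<delta> L = commutator A L"
proof -
  interpret shift_derivation \<delta>
    using assms by (simp add: lax_flow_of_iff)
  have "lift L = lax_deriv Ns \<delta>"
    by (simp add: L_def lax_op_def lax_deriv_def lift_add lift_sum lift_dterm)
  then show ?thesis
    using assms by (simp add: lax_flow_of_def L_def)
qed

lemma admissible_imp_lax_flow_of:
  "admissible A \<Longrightarrow> lax_flow_of N Ns A (evol (\<lambda>i. dcoeff (commutator A L) (Ns i)))"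
  by (simp add: lax_flow_of_iff shift_derivation_evol evol_gen)

lemma lax_flow_of_unique:
  "lax_flow_of N Ns A \<delta> \<Longrightarrow> lax_flow_of N Ns A \<delta>' \<Longrightarrow> \<delta> = \<delta>'"
  by (rule shift_derivation_eqI) (auto simp: lax_flow_of_iff)


section \<open>The hierarchy and its conserved densities\<close>

text \<open>By the Jacobi identity, the two mixed second derivatives of \<open>L\<close> differ by
  the commutator of \<open>L\<close> with the zero curvature expression of the two powers, which
  vanishes because the powers commute.\<close>

lemma lax_flow_of_power_commute:
  assumes "lax_flow_of N Ns (plus_part (L ^ a)) \<delta>" "lax_flow_of N Ns (plus_part (L ^ b)) \<delta>'"
  shows "\<delta> \<circ> \<delta>' = \<delta>' \<circ> \<delta>"
proof
  fix f
  interpret d: shift_derivation \<delta>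
    using assms by (simp add: lax_flow_of_iff)
  interpret d': shift_derivation \<delta>'
    using assms by (simp add: lax_flow_of_iff)
  let ?R = "L ^ a" and ?T = "L ^ b"
  have dL: "d.lift L = commutator (plus_part ?R) L" and d'L: "d'.lift L = commutator (plus_part ?T) L"
    using assms lift_L by blast+
  have "d.lift (d'.lift L) = commutator (plus_part (commutator (plus_part ?R) ?T)) L +
      commutator (plus_part ?T) (commutator (plus_part ?R) L)"
    by (simp add: d'L dL d.lift_commutator d.lift_plus_part d.lift_power)
  moreover have "d'.lift (d.lift L) = commutator (plus_part (commutator (plus_part ?T) ?R)) L +
      commutator (plus_part ?R) (commutator (plus_part ?T) L)"
    by (simp add: d'L dL d'.lift_commutator d'.lift_plus_part d'.lift_power)
  ultimately have "d.lift (d'.lift L) - d'.lift (d.lift L) =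
      commutator (plus_part (commutator (plus_part ?R) ?T) - plus_part (commutator (plus_part ?T) ?R)) L -
      commutator (commutator (plus_part ?R) (plus_part ?T)) L"
    by (simp add: commutator_minus_left jacobi)
  also have "\<dots> = 0"
    by (simp add: zero_curvature_plus_part)
  finally have "d.lift (d'.lift L) = d'.lift (d.lift L)"
    by simp
  \<comment> \<open>The generator with index \<open>i\<close> is the coefficient of \<open>L\<close>
    at order \<open>Ns i\<close>.\<close>
  then have gen: "\<delta> (\<delta>' (gen i)) = \<delta>' (\<delta> (gen i))" for i
    by (metis d.dcoeff_lift d'.dcoeff_lift dcoeff_L_expo factor.simps(2))
  show "(\<delta> \<circ> \<delta>') f = (\<delta>' \<circ> \<delta>) f"
  proof (induction f rule: dpoly_induct)
    case (var i j)
    have "\<delta> (\<delta>' (var i j)) = shift j (\<delta> (\<delta>' (gen i)))" "\<delta>' (\<delta> (var i j)) = shift j (\<delta>' (\<delta> (gen i)))"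
      by (simp_all only: d.var[of i j] d'.var[of i j] d.shift d'.shift)
    then show ?case using gen[of i] by simp
  qed (simp_all add: d.add d'.add d.mult d'.mult algebra_simps)
qed

lemma ex1_lax_hierarchy:
  assumes "\<And>k. k > 0 \<Longrightarrow> admissible (plus_part (L ^ (q * k)))"
  shows "\<exists>!\<delta>. lax_hierarchy N Ns q \<delta>"
proof
  let ?A = "\<lambda>k. plus_part (L ^ (q * k))"
  \<comment> \<open>The value \<open>undefined\<close> at 0 is the one that
    \<open>extensional\<close> prescribes.\<close>
  let ?d = "\<lambda>k::nat. if k > 0 then evol (\<lambda>i. dcoeff (commutator (?A k) L) (Ns i)) else undefined"
  have flow: "lax_flow_of N Ns (?A k) (?d k)" if "k > 0" for k
    using admissible_imp_lax_flow_of[OF assms[OF that]] that by simp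
  have "?d \<in> extensional {0<..}"
    by (simp add: extensional_def)
  then show "lax_hierarchy N Ns q ?d"
    unfolding lax_hierarchy_def L_def[symmetric]
    using flow lax_flow_of_power_commute by blast
  fix \<delta>
  assume h: "lax_hierarchy N Ns q \<delta>"
  show "\<delta> = ?d"
  proof
    fix k
    show "\<delta> k = ?d k"
    proof (cases "k > 0")
      case True
      then have "lax_flow_of N Ns (?A k) (\<delta> k)"
        using h by (simp add: lax_hierarchy_def L_def)
      then show ?thesis
        using flow[OF True] lax_flow_of_unique by blast
    next
      case False
      then show ?thesis
        using h by (simp add: lax_hierarchy_def extensional_def)
    qed
  qed
qed

text \<open>The Lax equation passes to \<open>L ^ b\<close>, and residues of commutators are total
  differences. The argument applies to every Lax flow.\<close>

lemma conserved_Res_power: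
  assumes "lax_flow_of N Ns A \<delta>"
  shows "\<delta> (Res (L ^ b)) \<in> total_differences"
proof -
  interpret shift_derivation \<delta>
    using assms by (simp add: lax_flow_of_iff)
  have "\<delta> (Res (L ^ b)) = Res (lift (L ^ b))"
    by (simp add: Res_def dcoeff_lift)
  also have "\<dots> = Res (commutator A (L ^ b))"
    using lift_power[OF lift_L[OF assms]] by simp
  finally show ?thesis
    by (simp add: Res_commutator_total_differences)
qed


section \<open>Powers of the Lax operator\<close>

lemma dcoeff_commutator_plus_part_low:
  assumes "t < Ns trail"
  shows "dcoeff (commutator (plus_part R) L) t = 0"
  unfolding dcoeff_commutator_L
proof (rule sum.neutral, rule)
  fix x
  have "t - expo x < 0"
    using assms expo_ge[of x] by linarith
  then show "dcoeff (plus_part R) (t - expo x) * shift (t - expo x) (factor x) -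
      factor x * shift (expo x) (dcoeff (plus_part R) (t - expo x)) = 0"
    by (simp add: dcoeff_plus_part)
qed

lemma dcoeff_commutator_minus_part_high:
  assumes "N \<le> t"
  shows "dcoeff (commutator (minus_part R) L) t = 0"
  unfolding dcoeff_commutator_L
proof (rule sum.neutral, rule)
  fix x
  have "t - expo x \<ge> 0"
    using assms expo_le[of x] by linarith
  then show "dcoeff (minus_part R) (t - expo x) * shift (t - expo x) (factor x) -
      factor x * shift (expo x) (dcoeff (minus_part R) (t - expo x)) = 0"
    by (simp add: dcoeff_minus_part)
qed

lemma commutator_minus_part_power:
  "commutator (minus_part (L ^ r)) L = - commutator (plus_part (L ^ r)) L"
  by (simp add: minus_part_def commutator_minus_left)

lemma dcoeff_power_Suc:
  "dcoeff (L ^ Suc r) t = (\<Sum>x\<in>UNIV. dcoeff (L ^ r) (t - expo x) * shift (t - expo x) (factor x))"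
  by (simp add: power_Suc2 dcoeff_mult_L del: power_Suc)

lemma dvd_of_dcoeff_power_nonzero:
  assumes "\<And>i. p dvd N - Ns i" "dcoeff (L ^ r) t \<noteq> 0"
  shows "p dvd int r * N - t"
  using assms(2)
proof (induction r arbitrary: t)
  case 0
  then show ?case by (simp add: dcoeff_one split: if_splits)
next
  case (Suc r)
  then obtain x where "dcoeff (L ^ r) (t - expo x) \<noteq> 0"
    unfolding dcoeff_power_Suc by (metis (no_types, lifting) mult_zero_left sum.neutral)
  then have "p dvd int r * N - (t - expo x)"
    by (rule Suc.IH)
  moreover have "p dvd N - expo x"
    using assms(1) by (cases x) auto
  ultimately have "p dvd (int r * N - (t - expo x)) + (N - expo x)"
    by (rule dvd_add)
  then show ?case by (simp add: algebra_simps)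
qed

text \<open>The commutators of \<open>L\<close> with the two halves of \<open>L ^ r\<close> are
  opposite. One has no orders below \<open>Ns trail\<close>, the other none from \<open>N\<close>
  on, and all orders are congruent to \<open>N\<close> modulo \<open>p\<close>; by
  \<open>full\<close>, what remains are exponents of \<open>L\<close>.\<close>

lemma admissible_plus_part_power:
  assumes p: "\<And>i. p dvd N - Ns i" "p dvd int r * N"
    and full: "\<And>t. Ns trail \<le> t \<Longrightarrow> t < N \<Longrightarrow> p dvd N - t \<Longrightarrow> t \<in> range Ns"
  shows "admissible (plus_part (L ^ r))"
  unfolding admissible_def
proof (intro allI impI)
  fix t
  assume t: "t \<notin> range Ns"
  have "dcoeff (commutator (plus_part (L ^ r)) L) t = 0" if "N \<le> t"
    using dcoeff_commutator_minus_part_high[OF that, of "L ^ r"]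
    by (simp add: commutator_minus_part_power dcoeff_uminus)
  moreover have "dcoeff (commutator (plus_part (L ^ r)) L) t = 0" if "t < Ns trail"
    using that by (rule dcoeff_commutator_plus_part_low)
  moreover have "dcoeff (commutator (plus_part (L ^ r)) L) t = 0" if "\<not> p dvd N - t"
    unfolding dcoeff_commutator_L
  proof (rule sum.neutral, rule)
    fix x
    have "dcoeff (L ^ r) (t - expo x) = 0"
    proof (rule ccontr)
      assume "dcoeff (L ^ r) (t - expo x) \<noteq> 0"
      then have "p dvd int r * N - (t - expo x)"
        by (rule dvd_of_dcoeff_power_nonzero[OF p(1)])
      moreover have "p dvd N - expo x"
        using p(1) by (cases x) auto
      ultimately have "p dvd (int r * N - (t - expo x)) + (N - expo x) - int r * N"
        using p(2) by (rule dvd_diff[OF dvd_add])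
      moreover have "int r * N - (t - expo x) + (N - expo x) - int r * N = N - t"
        by simp
      ultimately show False
        using that by (simp only:)
    qed
    then show "dcoeff (plus_part (L ^ r)) (t - expo x) * shift (t - expo x) (factor x) -
        factor x * shift (expo x) (dcoeff (plus_part (L ^ r)) (t - expo x)) = 0"
      by (simp add: dcoeff_plus_part)
  qed
  ultimately show "dcoeff (commutator (plus_part (L ^ r)) L) t = 0"
    using full[of t] t by fastforce
qed

end

section \<open>Trailing coefficients\<close>

text \<open>The coefficient of the \<open>k\<close>-th power of the operator
  \<open>dterm (gen i) n\<close>.\<close>

definition trail_monom :: "'m \<Rightarrow> int \<Rightarrow> nat \<Rightarrow> 'm dmonom" where
  "trail_monom i n k = (\<Sum>j<k. uvar (i, int j * n))"

lemma trail_monom_Suc: "trail_monom i n (Suc k) = trail_monom i n k + uvar (i, int k * n)"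
  by (simp add: trail_monom_def)

lemma mshift_trail_monom: "mshift n (trail_monom i n k) + uvar (i, 0) = trail_monom i n (Suc k)"
proof (induction k)
  case (Suc k)
  have "mshift n (trail_monom i n (Suc k)) + uvar (i, 0) =
      (mshift n (trail_monom i n k) + uvar (i, 0)) + uvar (i, int (Suc k) * n)"
    by (simp add: trail_monom_Suc mshift_add mshift_single algebra_simps)
  then show ?case
    by (simp only: Suc.IH trail_monom_Suc)
qed (simp add: trail_monom_def)

lemma lookup_trail_monom:
  assumes "n \<noteq> 0"
  shows "Poly_Mapping.lookup (trail_monom i n k) v = (if \<exists>j<k. v = (i, int j * n) then 1 else 0)"
proof (induction k)
  case (Suc k)
  have new: "\<not> (\<exists>j<k. (i, int k * n) = (i, int j * n))"
    using assms by auto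
  have split: "(\<exists>j<Suc k. v = (i, int j * n)) \<longleftrightarrow> v = (i, int k * n) \<or> (\<exists>j<k. v = (i, int j * n))"
    using less_Suc_eq by blast
  show ?case
    unfolding split using new Suc
    by (cases "v = (i, int k * n)") (simp_all add: trail_monom_Suc lookup_add lookup_single)
qed (simp add: trail_monom_def)

text \<open>For a monomial \<open>m\<close> of \<open>b\<close>, the equation forces the variable of
  index 0 to divide \<open>m\<close> times the variable of index \<open>l\<close>. Dividing it out
  and shifting by \<open>- n\<close> gives another monomial of \<open>b\<close>, to which the
  induction applies; \<open>l\<close> avoids the indices in question, so they come from
  \<open>m\<close>.\<close>

lemma trail_equation_lookup:
  assumes eq: "b * var i l = shift n b * var i 0"
    and m: "coef b m \<noteq> 0" and l: "\<And>j'. j' \<le> j \<Longrightarrow> l \<noteq> int j' * n"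
  shows "Poly_Mapping.lookup m (i, int j * n) \<noteq> 0"
  using m l
proof (induction j arbitrary: m)
  case 0
  have "coef (shift n b * var i 0) (m + uvar (i, l)) \<noteq> 0"
    using 0(1) by (simp add: coef_mult_var flip: eq)
  then have "Poly_Mapping.lookup (m + uvar (i, l)) (i, 0) \<noteq> 0"
    by (metis coef_mult_var_eq_0)
  then show ?case
    using 0(2)[of 0] by (simp add: lookup_add lookup_single)
next
  case (Suc j)
  have nz: "coef (shift n b * var i 0) (m + uvar (i, l)) \<noteq> 0"
    using Suc.prems(1) by (simp add: coef_mult_var flip: eq)
  then have "Poly_Mapping.lookup (m + uvar (i, l)) (i, 0) \<noteq> 0"
    by (metis coef_mult_var_eq_0)
  then obtain k where k: "m + uvar (i, l) = k + uvar (i, 0)"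
    by (rule uvar_decompose)
  have "coef b (mshift (- n) k) \<noteq> 0"
    using nz by (simp add: k coef_mult_var lookup_shift)
  then have "Poly_Mapping.lookup (mshift (- n) k) (i, int j * n) \<noteq> 0"
    using Suc.prems(2) by (intro Suc.IH) auto
  then have "Poly_Mapping.lookup (m + uvar (i, l)) (i, int (Suc j) * n) \<noteq> 0"
    by (simp add: k lookup_add lookup_mshift algebra_simps)
  then show ?case
    using Suc.prems(2)[of "Suc j"] by (simp add: lookup_add lookup_single when_def split: if_splits)
qed

text \<open>A monomial of \<open>b\<close> would be divisible by infinitely many distinct
  variables.\<close>

lemma trail_equation_eq_0:
  assumes eq: "b * var i l = shift n b * var i 0" and n: "n \<noteq> 0"
    and l: "\<And>j. l \<noteq> int j * n"
  shows "b = 0"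
proof (rule ccontr)
  assume "b \<noteq> 0"
  then obtain m where "coef b m \<noteq> 0"
    by (metis lookup_zero poly_mapping_eqI)
  then have "range (\<lambda>j. (i, int j * n)) \<subseteq> Poly_Mapping.keys m"
    using trail_equation_lookup[OF eq] l by (auto simp: in_keys_iff)
  moreover have "inj (\<lambda>j. (i, int j * n))"
    using n by (auto simp: inj_def)
  ultimately show False
    using finite_subset[OF _ finite_keys] finite_imageD by blast
qed

text \<open>The monomial \<open>trail_monom i n k\<close> solves the equation and divides every
  solution; the quotient is shift invariant, hence constant.\<close>

lemma trail_equation_solution:
  assumes eq: "b * var i (int k * n) = shift n b * var i 0" and n: "n \<noteq> 0"
  shows "\<exists>c. b = Poly_Mapping.single (trail_monom i n k) c"
proof -
  let ?M = "trail_monom i n k"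
  \<comment> \<open>The quotient of \<open>b\<close> by \<open>?M\<close>, keeping only the
    monomials divisible by \<open>?M\<close>; that none are lost is shown next.\<close>
  define b' where "b' = Poly_Mapping.map_key (\<lambda>m. m + ?M) b"
  have inj: "inj (\<lambda>m. m + ?M)"
    by (auto simp: inj_def)
  have coef_b': "coef b' m = coef b (m + ?M)" for m
    by (simp add: b'_def map_key.rep_eq[OF inj])
  have b: "b = b' * Poly_Mapping.single ?M 1"
  proof (rule poly_mapping_eqI)
    fix m
    show "coef b m = coef (b' * Poly_Mapping.single ?M 1) m"
    proof (cases "\<exists>m'. m = m' + ?M")
      case True
      then show ?thesis by (auto simp: coef_mult_single coef_b')
    next
      case False
      have "coef b m = 0"
      proof (rule ccontr)
        assume m: "coef b m \<noteq> 0"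
        have "Poly_Mapping.lookup m (i, int j * n) \<noteq> 0" if "j < k" for j
          by (rule trail_equation_lookup[OF eq m]) (use that n in auto)
        then have "m = (m - ?M) + ?M"
          by (intro poly_mapping_eqI)
            (auto simp: lookup_add lookup_minus lookup_trail_monom[OF n])
        then show False using False by blast
      qed
      then show ?thesis
        using False by (metis coef_mult_single_eq_0)
    qed
  qed
  \<comment> \<open>Both sides of the equation become multiples of the next monomial
    \<open>trail_monom i n (Suc k)\<close>, which is then cancelled.\<close>
  have "b' * Poly_Mapping.single (trail_monom i n (Suc k)) 1 = b * var i (int k * n)"
    by (simp add: b var_def mult.assoc mult_single trail_monom_Suc)
  also have "\<dots> = shift n b' * Poly_Mapping.single (trail_monom i n (Suc k)) 1"
    unfolding eq by (simp add: b shift_mult shift_single var_def mult.assoc mult_single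
        mshift_trail_monom[symmetric])
  finally have "coef b' m = coef (shift n b') m" for m
    using coef_mult_single[of b' "trail_monom i n (Suc k)" 1 m]
      coef_mult_single[of "shift n b'" "trail_monom i n (Suc k)" 1 m] by simp
  then have "b' = Const (coef b' 0)"
    using n by (metis poly_mapping_eqI shift_invariant_imp_Const)
  then have "b = Const (coef b' 0) * Poly_Mapping.single ?M 1"
    using b by simp
  then show ?thesis
    by (auto simp: Const_def mult_single)
qed

context lax_operator
begin

lemma dcoeff_commutator_L_single:
  assumes "\<And>x. x \<noteq> y \<Longrightarrow> dcoeff A (t - expo x) = 0"
  shows "dcoeff (commutator A L) t = dcoeff A (t - expo y) * shift (t - expo y) (factor y) -
     factor y * shift (expo y) (dcoeff A (t - expo y))"
proof -
  have "dcoeff (commutator A L) t = (\<Sum>x\<in>{y}. dcoeff A (t - expo x) * shift (t - expo x) (factor x) -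
     factor x * shift (expo x) (dcoeff A (t - expo x)))"
    unfolding dcoeff_commutator_L by (rule sum.mono_neutral_right) (auto simp: assms)
  then show ?thesis by simp
qed

lemma dcoeff_power_low: "t < int r * Ns trail \<Longrightarrow> dcoeff (L ^ r) t = 0"
proof (induction r arbitrary: t)
  case 0
  then show ?case by (simp add: dcoeff_one)
next
  case (Suc r)
  have "dcoeff (L ^ r) (t - expo x) = 0" for x
    using Suc.prems expo_ge[of x] by (intro Suc.IH) (simp add: algebra_simps)
  then show ?case
    by (simp add: dcoeff_power_Suc del: power_Suc)
qed

lemma dcoeff_power_trail:
  "dcoeff (L ^ r) (int r * Ns trail) = Poly_Mapping.single (trail_monom trail (Ns trail) r) 1"
proof (induction r)
  case 0
  then show ?case by (simp add: dcoeff_one trail_monom_def)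
next
  case (Suc r)
  let ?t = "int (Suc r) * Ns trail"
  let ?f = "\<lambda>x. dcoeff (L ^ r) (?t - expo x) * shift (?t - expo x) (factor x)"
  have "?f x = 0" if "x \<noteq> Some trail" for x
  proof -
    have "expo x \<noteq> Ns trail"
      using that expo_eq_iff[of x "Some trail"] by simp
    then have "?t - expo x < int r * Ns trail"
      using expo_ge[of x] by (simp add: algebra_simps)
    then show ?thesis by (simp add: dcoeff_power_low)
  qed
  then have "dcoeff (L ^ Suc r) ?t = sum ?f {Some trail}"
    unfolding dcoeff_power_Suc by (intro sum.mono_neutral_right) auto
  also have "\<dots> = dcoeff (L ^ r) (int r * Ns trail) * var trail (int r * Ns trail)"
    by (simp add: shift_var algebra_simps)
  finally show ?case
    by (simp add: Suc var_def mult_single trail_monom_Suc)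
qed

section \<open>Removing the negative orders of an admissible operator\<close>

lemma admissible_cong: "commutator A L = commutator B L \<Longrightarrow> admissible A \<longleftrightarrow> admissible B"
  by (simp add: admissible_def)

text \<open>Induction on the depth of the negative orders. The lowest coefficient solves the
  trailing equation, so it is 0 or a constant multiple of the trailing coefficient of a power of
  \<open>L\<close>; subtracting that multiple of the power does not change the commutator.\<close>

lemma admissible_imp_nonneg:
  assumes "admissible A" "\<And>n. n < - int l \<Longrightarrow> dcoeff A n = 0"
  shows "\<exists>A'. (\<forall>n<0. dcoeff A' n = 0) \<and> commutator A' L = commutator A L"
  using assms
proof (induction l arbitrary: A)
  case 0
  then show ?case by auto
next
  case (Suc l)
  let ?n = "Ns trail" and ?l = "- int (Suc l)"
  define b where "b = dcoeff A ?l"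
  have zero: "dcoeff A (?l + ?n - expo x) = 0" if "x \<noteq> Some trail" for x
  proof -
    have "expo x \<noteq> ?n"
      using that expo_eq_iff[of x "Some trail"] by simp
    then have "?l + ?n - expo x < ?l"
      using expo_ge[of x] by simp
    then show ?thesis by (rule Suc.prems(2))
  qed
  \<comment> \<open>This order lies below all exponents, so admissibility applies to it, and only
    the trailing term of \<open>L\<close> contributes.\<close>
  have "?l + ?n < Ns i" for i
    using Ns_ge_trail[of i] by linarith
  then have "?l + ?n \<notin> range Ns"
    by force
  then have "dcoeff (commutator A L) (?l + ?n) = 0"
    using Suc.prems(1) unfolding admissible_def by blast
  then have "b * shift ?l (gen trail) - gen trail * shift ?n b = 0"
    using dcoeff_commutator_L_single[of "Some trail" A "?l + ?n", OF zero] by (simp add: b_def)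
  then have eq: "b * var trail ?l = shift ?n b * var trail 0"
    by (simp add: shift_var mult.commute)
  show ?case
  proof (cases "\<exists>k. ?l = int k * ?n")
    case True
    then obtain k where k: "?l = int k * ?n" ..
    obtain c where c: "b = Poly_Mapping.single (trail_monom trail ?n k) c"
      using trail_equation_solution[OF eq[unfolded k]] Ns_trail_neg by auto
    define B where "B = A - dterm (Const c) 0 * L ^ k"
    have comm: "commutator B L = commutator A L"
      by (simp add: B_def commutator_minus_left commutator_Const_mult)
    have "dcoeff B n = 0" if "n < - int l" for n
    proof (cases "n = ?l")
      case True
      have "dcoeff B n = b - Const c * dcoeff (L ^ k) (int k * ?n)"
        by (simp add: B_def b_def dcoeff_minus dcoeff_dterm_0_mult True flip: k)
      also have "\<dots> = 0"
        by (simp add: c dcoeff_power_trail Const_def mult_single)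
      finally show ?thesis .
    next
      case False
      then have "n < ?l" using that by simp
      then show ?thesis
        using Suc.prems(2)[of n] dcoeff_power_low[of n k] k
        by (simp add: B_def dcoeff_minus dcoeff_dterm_0_mult)
    qed
    then show ?thesis
      using Suc.IH[of B] Suc.prems(1) comm admissible_cong[OF comm] by auto
  next
    case False
    then have "b = 0"
      using trail_equation_eq_0[OF eq] Ns_trail_neg by auto
    then have "dcoeff A n = 0" if "n < - int l" for n
      using that Suc.prems(2)[of n] by (cases "n = ?l") (auto simp: b_def)
    then show ?thesis
      using Suc.IH[of A] Suc.prems(1) by blast
  qed
qed

lemma admissible_nonnegE:
  assumes "admissible A"
  obtains A' where "\<And>n. n < 0 \<Longrightarrow> dcoeff A' n = 0" "commutator A' L = commutator A L"
proof -
  \<comment> \<open>Inserting 0 makes the minimum exist for \<open>A = 0\<close> and keeps it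
    nonpositive.\<close>
  define l where "l = nat (- Min (insert 0 (supp A)))"
  have "dcoeff A n = 0" if "n < - int l" for n
  proof (rule ccontr)
    assume "dcoeff A n \<noteq> 0"
    then have "Min (insert 0 (supp A)) \<le> n"
      by (intro Min_le) (auto simp: finite_supp, simp add: supp_def)
    then show False using that by (simp add: l_def split: if_splits)
  qed
  then show thesis
    using admissible_imp_nonneg[OF assms] that by blast
qed


section \<open>Leading coefficients\<close>

text \<open>At order \<open>n + N\<close>, above all exponents because \<open>n\<close> is
  nonnegative, only the leading term of \<open>L\<close> contributes: the coefficient is fixed by
  \<open>shift N\<close>.\<close>

lemma admissible_lead_Const:
  assumes "admissible A" "0 \<le> n" "\<And>k. n < k \<Longrightarrow> dcoeff A k = 0"
  obtains c where "dcoeff A n = Const c"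
proof -
  have zero: "dcoeff A (n + N - expo x) = 0" if "x \<noteq> None" for x
  proof -
    have "expo x \<noteq> N"
      using that expo_eq_iff[of x None] by simp
    then have "n < n + N - expo x"
      using expo_le[of x] by simp
    then show ?thesis by (rule assms(3))
  qed
  have "n + N > Ns i" for i
    using Ns_less[of i] assms(2) by linarith
  then have "n + N \<notin> range Ns"
    by force
  then have "dcoeff (commutator A L) (n + N) = 0"
    using assms(1) unfolding admissible_def by blast
  then have "shift N (dcoeff A n) = dcoeff A n"
    using dcoeff_commutator_L_single[of None A "n + N", OF zero] by simp
  then show thesis
    using shift_invariant_imp_Const N_pos that by (metis less_irrefl)
qed

section \<open>Linear combinations of flows and flows of bounded order\<close>

lemma lax_flow_of_diff_scale:
  assumes A: "lax_flow_of N Ns A \<delta>" and B: "lax_flow_of N Ns B \<epsilon>"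
  shows "lax_flow_of N Ns (A - dterm (Const c) 0 * B) (\<delta> - flow_scale c \<epsilon>)"
proof -
  interpret d: shift_derivation \<delta> using A by (simp add: lax_flow_of_iff)
  interpret e: shift_derivation \<epsilon> using B by (simp add: lax_flow_of_iff)
  have "shift_derivation (\<delta> - flow_scale c \<epsilon>)"
  proof
    show "derivation (\<delta> - flow_scale c \<epsilon>)"
      unfolding derivation_def
    proof (intro conjI allI)
      fix a and f g
      show "(\<delta> - flow_scale c \<epsilon>) (f + g) = (\<delta> - flow_scale c \<epsilon>) f + (\<delta> - flow_scale c \<epsilon>) g"
        by (simp add: flow_scale_def d.add e.add algebra_simps)
      show "(\<delta> - flow_scale c \<epsilon>) (Const a * f) = Const a * (\<delta> - flow_scale c \<epsilon>) f"
        by (simp add: flow_scale_def d.scale e.scale right_diff_distrib mult.left_commute)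
      show "(\<delta> - flow_scale c \<epsilon>) (f * g) =
          (\<delta> - flow_scale c \<epsilon>) f * g + f * (\<delta> - flow_scale c \<epsilon>) g"
        by (simp add: flow_scale_def d.mult e.mult) (simp add: algebra_simps)
    qed
  next
    fix f
    show "(\<delta> - flow_scale c \<epsilon>) (shift 1 f) = shift 1 ((\<delta> - flow_scale c \<epsilon>) f)"
      by (simp add: flow_scale_def d.shift_1 e.shift_1 shift_minus shift_mult shift_Const)
  qed
  moreover have comm: "dcoeff (commutator (A - dterm (Const c) 0 * B) L) t =
      dcoeff (commutator A L) t - Const c * dcoeff (commutator B L) t" for t
    by (simp add: commutator_minus_left commutator_Const_mult dcoeff_minus dcoeff_dterm_0_mult)
  ultimately show ?thesis
    using A B unfolding lax_flow_of_iff admissible_def comm by (simp add: flow_scale_def)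
qed

text \<open>Leading coefficients are constants, so each further order adds at most one dimension: a
  single flow attaining that order suffices to reduce all the others.\<close>

lemma bounded_order_flows_finite_span:
  "\<exists>G. finite G \<and> (\<forall>A \<delta>. lax_flow_of N Ns A \<delta> \<longrightarrow> (\<forall>n<0. dcoeff A n = 0) \<longrightarrow>
     (\<forall>n\<ge>int K. dcoeff A n = 0) \<longrightarrow> \<delta> \<in> flows.span G)"
proof (induction K)
  case 0
  have zero: "\<delta> = 0" if "lax_flow_of N Ns A \<delta>" "\<forall>n<0. dcoeff A n = 0" "\<forall>n\<ge>int 0. dcoeff A n = 0" for A \<delta>
  proof -
    have "A = 0"
      using that by (intro dop_eqI) (metis dcoeff_zero linorder_not_less of_nat_0)
    then have "shift_derivation \<delta>" "\<And>i. \<delta> (gen i) = 0"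
      using that(1) by (auto simp: lax_flow_of_iff)
    moreover have "shift_derivation (0 :: 'm dpoly \<Rightarrow> 'm dpoly)"
      by unfold_locales (simp_all add: derivation_def)
    ultimately show ?thesis
      by (intro shift_derivation_eqI) simp_all
  qed
  show ?case
    by (intro exI[of _ "{}"]) (use zero flows.span_zero in blast)
next
  case (Suc K)
  then obtain G where fin: "finite G" and G: "\<And>A \<delta>. lax_flow_of N Ns A \<delta> \<Longrightarrow> \<forall>n<0. dcoeff A n = 0 \<Longrightarrow>
     \<forall>n\<ge>int K. dcoeff A n = 0 \<Longrightarrow> \<delta> \<in> flows.span G"
    by auto
  have top: "\<forall>n\<ge>int K. dcoeff A n = 0" if "\<forall>n\<ge>int (Suc K). dcoeff A n = 0" "dcoeff A (int K) = 0" for A :: "'m dop"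
  proof (intro allI impI)
    fix n assume "n \<ge> int K"
    then show "dcoeff A n = 0"
      using that by (cases "n = int K") auto
  qed
  show ?case
  proof (cases "\<exists>A \<delta>. lax_flow_of N Ns A \<delta> \<and> (\<forall>n<0. dcoeff A n = 0) \<and>
      (\<forall>n\<ge>int (Suc K). dcoeff A n = 0) \<and> dcoeff A (int K) \<noteq> 0")
    case False
    show ?thesis
    proof (intro exI[of _ G] conjI allI impI fin)
      fix A \<delta>
      assume A: "lax_flow_of N Ns A \<delta>" "\<forall>n<0. dcoeff A n = 0" "\<forall>n\<ge>int (Suc K). dcoeff A n = 0"
      then have "dcoeff A (int K) = 0"
        using False by blast
      then show "\<delta> \<in> flows.span G"
        using G[OF A(1,2)] top[OF A(3)] by blast
    qed
  next
    case True
    then obtain B \<epsilon> where B: "lax_flow_of N Ns B \<epsilon>" "\<forall>n<0. dcoeff B n = 0"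
        "\<forall>n\<ge>int (Suc K). dcoeff B n = 0" "dcoeff B (int K) \<noteq> 0"
      by blast
    have lead: "\<exists>c. dcoeff A (int K) = Const c"
      if "lax_flow_of N Ns A \<delta>" "\<forall>n\<ge>int (Suc K). dcoeff A n = 0" for A \<delta>
    proof -
      have "admissible A" using that(1) by (simp add: lax_flow_of_iff)
      then show ?thesis
        using that(2) by (elim admissible_lead_Const[of A "int K"]) auto
    qed
    obtain c0 where c0: "dcoeff B (int K) = Const c0"
      using lead B by blast
    then have "c0 \<noteq> 0"
      using B(4) by auto
    have "\<delta> \<in> flows.span (insert \<epsilon> G)"
      if A: "lax_flow_of N Ns A \<delta>" "\<forall>n<0. dcoeff A n = 0" "\<forall>n\<ge>int (Suc K). dcoeff A n = 0" for A \<delta>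
    proof -
      obtain c where c: "dcoeff A (int K) = Const c"
        using lead A by blast
      \<comment> \<open>The factor \<open>c / c0\<close> cancels the coefficient of order
        \<open>K\<close>.\<close>
      let ?A = "A - dterm (Const (c / c0)) 0 * B"
      have "\<delta> - flow_scale (c / c0) \<epsilon> \<in> flows.span G"
      proof (rule G)
        show "lax_flow_of N Ns ?A (\<delta> - flow_scale (c / c0) \<epsilon>)"
          using A(1) B(1) by (rule lax_flow_of_diff_scale)
        show "\<forall>n<0. dcoeff ?A n = 0"
          using A(2) B(2) by (simp add: dcoeff_minus dcoeff_dterm_0_mult)
        show "\<forall>n\<ge>int K. dcoeff ?A n = 0"
          using A(3) B(3) \<open>c0 \<noteq> 0\<close> by (intro top) (simp_all add: dcoeff_minus dcoeff_dterm_0_mult c c0 Const_mult)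
      qed
      then have "\<delta> - flow_scale (c / c0) \<epsilon> \<in> flows.span (insert \<epsilon> G)"
        using flows.span_mono[of G "insert \<epsilon> G"] by blast
      moreover have "flow_scale (c / c0) \<epsilon> \<in> flows.span (insert \<epsilon> G)"
        by (intro flows.span_scale flows.span_base) simp
      ultimately have "\<delta> - flow_scale (c / c0) \<epsilon> + flow_scale (c / c0) \<epsilon> \<in> flows.span (insert \<epsilon> G)"
        by (rule flows.span_add)
      then show ?thesis by simp
    qed
    then show ?thesis
      using fin by (intro exI[of _ "insert \<epsilon> G"]) blast
  qed
qed

text \<open>An infinite independent set does not fit into the finite-dimensional span of the flows
  of order below \<open>K\<close>. A flow outside it, after removal of the negative orders, has
  order at least \<open>K\<close>.\<close>

lemma infinite_flows_unbounded_order: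
  assumes "infinite F" "\<And>\<delta>. \<delta> \<in> F \<Longrightarrow> lax_flow N Ns \<delta>" "flows.independent F"
  obtains A n c where "admissible A" "\<And>k. k < 0 \<Longrightarrow> dcoeff A k = 0" "\<And>k. n < k \<Longrightarrow> dcoeff A k = 0"
    "dcoeff A n = Const c" "c \<noteq> 0" "int K \<le> n"
proof -
  obtain G where G: "finite G" "\<And>A \<delta>. lax_flow_of N Ns A \<delta> \<Longrightarrow> \<forall>n<0. dcoeff A n = 0 \<Longrightarrow>
     \<forall>n\<ge>int K. dcoeff A n = 0 \<Longrightarrow> \<delta> \<in> flows.span G"
    using bounded_order_flows_finite_span[of K] by blast
  have "\<not> F \<subseteq> flows.span G"
    using flows.independent_span_bound[OF G(1) assms(3)] assms(1) by blast
  then obtain \<delta> where "\<delta> \<in> F" "\<delta> \<notin> flows.span G"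
    by blast
  then obtain A0 where \<delta>: "lax_flow_of N Ns A0 \<delta>" "\<delta> \<notin> flows.span G"
    using assms(2) unfolding lax_flow_def by blast
  obtain A where A: "\<And>n. n < 0 \<Longrightarrow> dcoeff A n = 0" "commutator A L = commutator A0 L"
    using \<delta>(1) admissible_nonnegE lax_flow_of_iff by blast
  have flow: "lax_flow_of N Ns A \<delta>"
    using \<delta>(1) A(2) admissible_cong[OF A(2)] by (simp add: lax_flow_of_iff)
  then obtain k where k: "k \<ge> int K" "dcoeff A k \<noteq> 0"
    using G(2) A(1) \<delta>(2) by blast
  define n where "n = Max (supp A)"
  have "k \<in> supp A" using k by (simp add: supp_def)
  then have "n \<in> supp A" "k \<le> n"
    using Max_in[OF finite_supp, of A] Max_ge[OF finite_supp, of k A] by (auto simp: n_def)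
  have above: "dcoeff A j = 0" if "n < j" for j
    using Max_ge[OF finite_supp, of j A] that by (auto simp: n_def supp_def)
  have adm: "admissible A"
    using flow by (simp add: lax_flow_of_iff)
  have "0 \<le> n"
    using k(1) \<open>k \<le> n\<close> by linarith
  then obtain c where c: "dcoeff A n = Const c"
    using admissible_lead_Const[OF adm _ above] by blast
  have "c \<noteq> 0"
    using c \<open>n \<in> supp A\<close> by (auto simp: supp_def)
  show thesis
    by (rule that[OF adm A(1) above c \<open>c \<noteq> 0\<close>]) (use k(1) \<open>k \<le> n\<close> in auto)
qed

text \<open>At order \<open>n + Ns lead\<close>, above \<open>N\<close> by the last hypothesis, only
  the two leading terms of \<open>L\<close> contribute. Hence \<open>c\<close> times the difference
  of the variables of indices \<open>n\<close> and 0 lies in the image of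
  \<open>shift N - 1\<close>, which forces these indices to be congruent modulo
  \<open>N\<close>.\<close>

lemma dvd_admissible_order:
  assumes "admissible A" "\<And>k. n < k \<Longrightarrow> dcoeff A k = 0" "dcoeff A n = Const c" "c \<noteq> 0"
    "N - Ns lead < n"
  shows "N dvd n"
proof (rule ccontr)
  assume ndvd: "\<not> N dvd n"
  let ?t = "n + Ns lead"
  define a where "a = dcoeff A (?t - N)"
  let ?f = "\<lambda>x. dcoeff A (?t - expo x) * shift (?t - expo x) (factor x) -
     factor x * shift (expo x) (dcoeff A (?t - expo x))"
  have "?f x = 0" if x: "x \<notin> {None, Some lead}" for x
  proof -
    obtain i where i: "x = Some i" "i \<noteq> lead"
      using x by (cases x) auto
    have "Ns i < Ns lead"
      using i(2) Ns_le_lead[of i] by (simp add: order_less_le)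
    then show ?thesis using assms(2) i(1) by simp
  qed
  then have "dcoeff (commutator A L) ?t = sum ?f {None, Some lead}"
    unfolding dcoeff_commutator_L by (intro sum.mono_neutral_right) auto
  moreover have "?t \<noteq> Ns i" for i
    using assms(5) Ns_less[of i] by linarith
  then have "dcoeff (commutator A L) ?t = 0"
    using assms(1) by (auto simp: admissible_def)
  ultimately have eq: "a - shift N a + (Const c * var lead n - var lead 0 * Const c) = 0"
    by (simp add: a_def assms(3) shift_var shift_Const)
  have cv: "coef (Const c * var lead j) (uvar (lead, i)) = (if i = j then c else 0)" for i j
    by (auto simp: Const_def var_def mult_single lookup_single when_def)
  \<comment> \<open>Only the linear monomials with index divisible by \<open>N\<close> are followed.
    If \<open>N\<close> does not divide \<open>n\<close>, then \<open>\<beta>\<close> is constant on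
    each side of a jump by \<open>c\<close> at 0, which contradicts finite support.\<close>
  define \<beta> where "\<beta> k = coef a (uvar (lead, k * N))" for k
  have step: "\<beta> k - \<beta> (k - 1) = (if k = 0 then c else 0)" for k
  proof -
    have "0 = coef (a - shift N a + (Const c * var lead n - Const c * var lead 0)) (uvar (lead, k * N))"
      using eq by (simp add: mult.commute)
    moreover have "mshift (- N) (uvar (lead, k * N)) = uvar (lead, (k - 1) * N)"
      by (simp add: mshift_single algebra_simps)
    moreover have "k * N \<noteq> n"
      using ndvd by auto
    ultimately have "0 = \<beta> k - \<beta> (k - 1) - (if k = 0 then c else 0)"
      using N_pos by (simp add: \<beta>_def lookup_add lookup_minus cv lookup_shift)
    then show ?thesis by simp
  qed
  have fin: "finite {k. \<beta> k \<noteq> 0}"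
  proof -
    have "inj (\<lambda>k. uvar (lead, k * N))"
      using N_pos by (auto simp: inj_def)
    then have "finite ((\<lambda>k. uvar (lead, k * N)) -` Poly_Mapping.keys a)"
      by (rule finite_vimageI[OF finite_keys])
    moreover have "(\<lambda>k. uvar (lead, k * N)) -` Poly_Mapping.keys a = {k. \<beta> k \<noteq> 0}"
      by (auto simp: \<beta>_def in_keys_iff)
    ultimately show ?thesis by simp
  qed
  have up: "\<beta> (int k) = \<beta> 0" for k
    using step by (induction k) (auto, metis add_diff_cancel_left' eq_iff_diff_eq_0 of_nat_Suc of_nat_neq_0)
  have down: "\<beta> (- int k - 1) = \<beta> (- 1)" for k
  proof (induction k)
    case (Suc k)
    then show ?case using step[of "- int k - 1"] by (simp add: algebra_simps)
  qed simp
  have "\<beta> 0 = 0"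
  proof (rule ccontr)
    assume "\<beta> 0 \<noteq> 0"
    then have "range int \<subseteq> {k. \<beta> k \<noteq> 0}"
      using up by auto
    then show False
      using fin finite_subset finite_imageD[OF _ inj_of_nat] by blast
  qed
  moreover have "\<beta> (- 1) = 0"
  proof (rule ccontr)
    assume "\<beta> (- 1) \<noteq> 0"
    then have "range (\<lambda>k. - int k - 1) \<subseteq> {k. \<beta> k \<noteq> 0}"
      using down by auto
    moreover have "inj (\<lambda>k. - int k - 1)"
      by (auto simp: inj_def)
    ultimately show False
      using fin finite_subset finite_imageD by blast
  qed
  ultimately show False
    using step[of 0] assms(4) by simp
qed


section \<open>Homogeneous operators\<close>

text \<open>\<open>L\<close> is homogeneous of weight \<open>N\<close> when \<open>\<S>\<close> has weight \<open>1\<close> and \<open>u\<^sub>i\<close> has weight \<open>N - N\<^sub>i\<close>.\<close>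

definition wgt :: "'m \<Rightarrow> int" where
  "wgt i = N - Ns i"

definition hpart :: "int \<Rightarrow> 'm dop \<Rightarrow> 'm dop" where
  "hpart w P = (\<Sum>n\<in>supp P. dterm (wpart wgt (w - n) (dcoeff P n)) n)"

lemma dcoeff_hpart: "dcoeff (hpart w P) n = wpart wgt (w - n) (dcoeff P n)"
  by (simp add: hpart_def dcoeff_sum dcoeff_dterm finite_supp sum.delta) (auto simp: supp_def)

lemma wpart_mult_factor:
  "wpart wgt w (f * shift n (factor x)) = wpart wgt (w - N + expo x) f * shift n (factor x)"
  by (cases x) (simp_all add: shift_var wpart_mult_var wgt_def algebra_simps)

text \<open>Since \<open>L\<close> is homogeneous of weight \<open>N\<close>, commuting with it
  raises every weight by \<open>N\<close>. Admissibility can thus be tested on homogeneous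
  parts.\<close>

lemma commutator_hpart: "commutator (hpart w A) L = hpart (w + N) (commutator A L)"
proof (rule dop_eqI)
  fix t
  have "wpart wgt (w + N - t) (factor x * shift (expo x) (dcoeff A (t - expo x))) =
      factor x * shift (expo x) (wpart wgt (w - (t - expo x)) (dcoeff A (t - expo x)))" for x
    using wpart_mult_factor[of "w + N - t" "shift (expo x) (dcoeff A (t - expo x))" 0 x]
    by (simp add: wpart_shift mult.commute algebra_simps)
  moreover have "wpart wgt (w + N - t) (dcoeff A (t - expo x) * shift (t - expo x) (factor x)) =
      wpart wgt (w - (t - expo x)) (dcoeff A (t - expo x)) * shift (t - expo x) (factor x)" for x
    by (simp add: wpart_mult_factor algebra_simps)
  ultimately show "dcoeff (commutator (hpart w A) L) t = dcoeff (hpart (w + N) (commutator A L)) t"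
    by (simp add: dcoeff_commutator_L dcoeff_hpart wpart_sum wpart_minus)
qed

lemma admissible_hpart: "admissible A \<Longrightarrow> admissible (hpart w A)"
  by (simp add: admissible_def commutator_hpart dcoeff_hpart)

lemma hpart_power: "hpart (int r * N) (L ^ r) = L ^ r"
proof (induction r)
  case 0
  show ?case
    using wpart_Const[of wgt _ 1] by (intro dop_eqI) (simp add: dcoeff_hpart dcoeff_one)
next
  case (Suc r)
  show ?case
  proof (rule dop_eqI)
    fix t
    have *: "wpart wgt (int r * N - (t - expo x)) (dcoeff (L ^ r) (t - expo x)) = dcoeff (L ^ r) (t - expo x)" for x
      using arg_cong[OF Suc, of "\<lambda>P. dcoeff P (t - expo x)"] by (simp add: dcoeff_hpart)
    have "int (Suc r) * N - t - N + expo x = int r * N - (t - expo x)" for x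
      by (simp add: algebra_simps)
    then show "dcoeff (hpart (int (Suc r) * N) (L ^ Suc r)) t = dcoeff (L ^ Suc r) t"
      by (simp only: dcoeff_hpart dcoeff_power_Suc wpart_sum wpart_mult_factor *)
  qed
qed

lemma dcoeff_power_high: "int r * N < t \<Longrightarrow> dcoeff (L ^ r) t = 0"
proof (induction r arbitrary: t)
  case 0
  then show ?case by (simp add: dcoeff_one)
next
  case (Suc r)
  have "dcoeff (L ^ r) (t - expo x) = 0" for x
    using Suc.prems expo_le[of x] by (intro Suc.IH) (simp add: algebra_simps)
  then show ?case
    by (simp add: dcoeff_power_Suc del: power_Suc)
qed

lemma dcoeff_power_lead: "dcoeff (L ^ r) (int r * N) = 1"
proof (induction r)
  case 0
  then show ?case by (simp add: dcoeff_one)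
next
  case (Suc r)
  let ?t = "int (Suc r) * N"
  let ?f = "\<lambda>x. dcoeff (L ^ r) (?t - expo x) * shift (?t - expo x) (factor x)"
  have "?f x = 0" if "x \<noteq> None" for x
  proof -
    have "expo x \<noteq> N"
      using that expo_eq_iff[of x None] by simp
    then have "int r * N < ?t - expo x"
      using expo_le[of x] by (simp add: algebra_simps)
    then show ?thesis by (simp add: dcoeff_power_high)
  qed
  then have "dcoeff (L ^ Suc r) ?t = sum ?f {None}"
    unfolding dcoeff_power_Suc by (intro sum.mono_neutral_right) auto
  moreover have "?t - N = int r * N"
    by (simp add: algebra_simps)
  ultimately show ?case
    by (simp add: Suc del: power_Suc)
qed

text \<open>
  The weight \<open>n\<close> part of \<open>A\<close> and \<open>c L\<^sup>r\<close> differ by an admissible operator whose leading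
  coefficient, if of order \<open>k \<ge> 0\<close>, is a constant of positive weight \<open>n - k\<close>.
\<close>

lemma admissible_imp_admissible_power:
  assumes A: "admissible A" "\<And>k. k < 0 \<Longrightarrow> dcoeff A k = 0" "\<And>k. n < k \<Longrightarrow> dcoeff A k = 0"
    and lead: "dcoeff A n = Const c" "c \<noteq> 0" and n: "n = int r * N"
  shows "admissible (plus_part (L ^ r))"
proof -
  define H where "H = hpart n A"
  define B where "B = H - dterm (Const c) 0 * L ^ r"
  have dcoeff_B: "dcoeff B k = wpart wgt (n - k) (dcoeff A k) - Const c * dcoeff (L ^ r) k" for k
    by (simp add: B_def H_def dcoeff_minus dcoeff_dterm_0_mult dcoeff_hpart)
  have H: "admissible H"
    unfolding H_def using A(1) by (rule admissible_hpart)
  have "commutator B L = commutator H L"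
    by (simp add: B_def commutator_minus_left commutator_Const_mult)
  then have B: "admissible B"
    using H admissible_cong by blast
  have hom: "wpart wgt (n - k) (dcoeff B k) = dcoeff B k" for k
  proof -
    have L: "wpart wgt (n - k) (dcoeff (L ^ r) k) = dcoeff (L ^ r) k"
      using arg_cong[OF hpart_power[of r], of "\<lambda>P. dcoeff P k"] by (simp add: dcoeff_hpart n)
    have C: "wpart d w (Const c * f) = Const c * wpart d w f" for d w and f :: "'m dpoly"
    proof (rule poly_mapping_eqI)
      fix m
      have "coef (Const c * g) m = c * coef g m" for g :: "'m dpoly"
        using coef_mult_single[of g 0 c m] by (simp add: Const_def mult.commute)
      then show "coef (wpart d w (Const c * f)) m = coef (Const c * wpart d w f) m"
        by (simp add: coef_wpart)
    qed
    have W: "wpart wgt (n - k) (wpart wgt (n - k) f) = wpart wgt (n - k) f" for f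
      by (rule poly_mapping_eqI) (simp add: coef_wpart)
    show ?thesis
      by (simp add: dcoeff_B wpart_minus C L W)
  qed
  have B_high: "dcoeff B k = 0" if "n \<le> k" for k
  proof (cases "k = n")
    case True
    have "dcoeff B n = wpart wgt 0 (dcoeff A n) - Const c * dcoeff (L ^ r) (int r * N)"
      by (simp add: dcoeff_B flip: n)
    then show ?thesis
      by (simp add: True lead(1) wpart_Const dcoeff_power_lead)
  next
    case False
    then show ?thesis
      using that by (simp add: dcoeff_B A(3) n dcoeff_power_high)
  qed
  have B_nonneg: "dcoeff B k = 0" if "k \<ge> 0" for k
  proof (rule ccontr)
    assume "dcoeff B k \<noteq> 0"
    then have "k \<in> supp B" by (simp add: supp_def)
    define j where "j = Max (supp B)"
    have "j \<in> supp B" "k \<le> j"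
      using Max_in[OF finite_supp, of B] Max_ge[OF finite_supp, of k B] \<open>k \<in> supp B\<close> by (auto simp: j_def)
    have above: "dcoeff B i = 0" if "j < i" for i
      using Max_ge[OF finite_supp, of i B] that by (auto simp: j_def supp_def)
    have "0 \<le> j"
      using \<open>k \<le> j\<close> that by linarith
    then obtain b where b: "dcoeff B j = Const b"
      using admissible_lead_Const[OF B _ above] by blast
    have "j < n"
      using B_high[of j] \<open>j \<in> supp B\<close> by (force simp: supp_def)
    then have "dcoeff B j = 0"
      using hom[of j] by (simp add: b wpart_Const)
    then show False
      using \<open>j \<in> supp B\<close> by (simp add: supp_def)
  qed
  \<comment> \<open>\<open>H\<close> has no negative orders and \<open>B\<close> no nonnegative
    ones, so \<open>H\<close> is the nonnegative part of the multiple of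
    \<open>L ^ r\<close>.\<close>
  have "H = dterm (Const c) 0 * plus_part (L ^ r)"
  proof (rule dop_eqI)
    fix k
    show "dcoeff H k = dcoeff (dterm (Const c) 0 * plus_part (L ^ r)) k"
      using B_nonneg[of k] A(2)[of k]
      by (cases "k \<ge> 0") (simp_all add: dcoeff_dterm_0_mult dcoeff_plus_part dcoeff_B H_def dcoeff_hpart)
  qed
  then have "Const c * dcoeff (commutator (plus_part (L ^ r)) L) t = dcoeff (commutator H L) t" for t
    by (simp add: commutator_Const_mult dcoeff_dterm_0_mult)
  then show ?thesis
    using H Const_mult_eq_0[OF _ lead(2)] unfolding admissible_def by metis
qed

end

section \<open>Monomials of powers of the Lax operator\<close>

lemma sum_Nats: "(\<And>x. x \<in> X \<Longrightarrow> f x \<in> \<nat>) \<Longrightarrow> sum f X \<in> (\<nat> :: 'a::semiring_1 set)"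
  by (induction X rule: infinite_finite_induct) auto

lemma sum_Nats_nonzero:
  fixes f :: "'x \<Rightarrow> complex"
  assumes "finite X" "\<And>x. x \<in> X \<Longrightarrow> f x \<in> \<nat>" "y \<in> X" "f y \<noteq> 0"
  shows "sum f X \<noteq> 0"
proof -
  have "\<forall>x\<in>X. \<exists>n. f x = of_nat n"
    using assms(2) by (auto simp: Nats_def)
  then obtain h where h: "\<And>x. x \<in> X \<Longrightarrow> f x = of_nat (h x)"
    using bchoice[of X "\<lambda>x n. f x = of_nat n"] by blast
  then have "sum f X = of_nat (sum h X)"
    by simp
  moreover have "sum h X \<noteq> 0"
    using assms h by auto
  ultimately show ?thesis
    by (metis of_nat_eq_0_iff)
qed

text \<open>Natural coefficients exclude cancellation: a monomial of one summand survives in the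
  sum.\<close>

definition nat_coeffs :: "'m dpoly \<Rightarrow> bool" where
  "nat_coeffs f \<longleftrightarrow> (\<forall>m. coef f m \<in> \<nat>)"

lemma nat_coeffs_mult_var: "nat_coeffs f \<Longrightarrow> nat_coeffs (f * var i j)"
  unfolding nat_coeffs_def
  by (metis Nats_0 coef_mult_var coef_mult_var_eq_0 uvar_decompose)

lemma nat_coeffs_shift: "nat_coeffs f \<Longrightarrow> nat_coeffs (shift n f)"
  by (simp add: nat_coeffs_def lookup_shift)

context lax_operator
begin

lemma nat_coeffs_mult_factor: "nat_coeffs f \<Longrightarrow> nat_coeffs (f * shift n (factor x))"
  by (cases x) (simp_all add: shift_var nat_coeffs_mult_var)

lemma nat_coeffs_power: "nat_coeffs (dcoeff (L ^ r) t)"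
proof (induction r arbitrary: t)
  case 0
  show ?case
    by (auto simp: nat_coeffs_def dcoeff_one lookup_one when_def)
next
  case (Suc r)
  then have "nat_coeffs (dcoeff (L ^ r) (t - expo x) * shift (t - expo x) (factor x))" for x
    by (simp add: nat_coeffs_mult_factor)
  then show ?case
    by (simp add: nat_coeffs_def dcoeff_power_Suc lookup_sum sum_Nats del: power_Suc)
qed

text \<open>
  A monomial of the coefficient of \<open>\<S>\<^sup>t\<close> in \<open>L\<^sup>r\<close> records the starting points \<open>s\<close> of the steps
  \<open>N\<^sub>i\<close> of a path of length \<open>r\<close> from \<open>0\<close> to \<open>t\<close>; the steps \<open>N\<close> leave no trace.
\<close>

definition has_path :: "nat \<Rightarrow> int \<Rightarrow> ('m \<Rightarrow> int \<Rightarrow> bool) \<Rightarrow> bool" where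
  "has_path r t P \<longleftrightarrow> (\<exists>m. coef (dcoeff (L ^ r) t) m \<noteq> 0 \<and>
     (\<forall>i s. Poly_Mapping.lookup m (i, s) \<noteq> 0 \<longrightarrow> P i s))"

lemma has_path_0: "has_path 0 0 P"
  by (auto simp: has_path_def dcoeff_one lookup_one intro!: exI[of _ 0])

text \<open>Appends the step \<open>x\<close> starting at \<open>t\<close>. Its monomial is not
  cancelled by other paths, since all coefficients are natural numbers.\<close>

lemma has_path_Suc:
  assumes "has_path r t P" "\<And>i. x = Some i \<Longrightarrow> P i t"
  shows "has_path (Suc r) (t + expo x) P"
proof -
  obtain m where m: "coef (dcoeff (L ^ r) t) m \<noteq> 0"
      "\<And>i s. Poly_Mapping.lookup m (i, s) \<noteq> 0 \<Longrightarrow> P i s"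
    using assms(1) by (auto simp: has_path_def)
  define m' where "m' = (case x of None \<Rightarrow> m | Some i \<Rightarrow> m + uvar (i, t))"
  let ?f = "\<lambda>y. coef (dcoeff (L ^ r) (t + expo x - expo y) * shift (t + expo x - expo y) (factor y)) m'"
  have "?f x \<noteq> 0"
    using m(1) by (cases x) (simp_all add: m'_def shift_var coef_mult_var)
  moreover have "?f y \<in> \<nat>" for y
    using nat_coeffs_mult_factor[OF nat_coeffs_power] by (simp add: nat_coeffs_def)
  ultimately have "(\<Sum>y\<in>UNIV. ?f y) \<noteq> 0"
    using sum_Nats_nonzero[of UNIV ?f x, OF finite] by blast
  then have "coef (dcoeff (L ^ Suc r) (t + expo x)) m' \<noteq> 0"
    by (simp only: dcoeff_power_Suc lookup_sum not_False_eq_True)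
  moreover have "P i s" if "Poly_Mapping.lookup m' (i, s) \<noteq> 0" for i s
    using that m(2) assms(2)
    by (cases x) (auto simp: m'_def lookup_add lookup_single when_def split: if_splits)
  ultimately show ?thesis
    unfolding has_path_def by blast
qed

text \<open>The steps in the multiset \<open>X\<close> can be ordered so that no recorded step ends
  below \<open>b\<close>.\<close>

lemma has_path_above:
  assumes "size X = r" "(\<Sum>x\<in>#X. expo x) \<ge> b" "b \<le> 0"
  shows "has_path r (\<Sum>x\<in>#X. expo x) (\<lambda>i s. s + Ns i \<ge> b)"
  using assms(1,2)
proof (induction r arbitrary: X)
  case 0
  then show ?case by (simp add: has_path_0)
next
  case (Suc r)
  \<comment> \<open>The last step is chosen nonpositive if possible, so that the sum before it is
    still at least \<open>b\<close>. Otherwise all steps are positive and any one will do, because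
    \<open>b \<le> 0\<close>.\<close>
  obtain x Y where X: "X = add_mset x Y" and Y: "(\<Sum>x\<in>#Y. expo x) \<ge> b"
  proof (cases "\<exists>x\<in>#X. expo x \<le> 0")
    case True
    then obtain x Y where "X = add_mset x Y" "expo x \<le> 0"
      by (metis multi_member_split)
    then show ?thesis using Suc.prems that by auto
  next
    case False
    obtain x Y where X: "X = add_mset x Y"
      using Suc.prems(1) by (metis size_eq_Suc_imp_eq_union)
    have "(\<Sum>x\<in>#Y. expo x) \<ge> (\<Sum>x\<in>#Y. 0)"
      using False X by (intro sum_mset_mono) auto
    then show ?thesis using X assms(3) that by auto
  qed
  have "has_path r (\<Sum>x\<in>#Y. expo x) (\<lambda>i s. s + Ns i \<ge> b)"
    using X Y Suc.prems(1) by (intro Suc.IH) auto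
  then have "has_path (Suc r) ((\<Sum>x\<in>#Y. expo x) + expo x) (\<lambda>i s. s + Ns i \<ge> b)"
    using X Suc.prems(2) by (intro has_path_Suc) auto
  then show ?case
    by (simp add: X add.commute)
qed

text \<open>Mirror image of \<open>has_path_above\<close>, now bounding the starting points: the
  last step is chosen nonnegative if possible.\<close>

lemma has_path_below:
  assumes "size X = r" "(\<Sum>x\<in>#X. expo x) \<le> b" "0 \<le> b"
  shows "has_path r (\<Sum>x\<in>#X. expo x) (\<lambda>i s. s \<le> b)"
  using assms(1,2)
proof (induction r arbitrary: X)
  case 0
  then show ?case by (simp add: has_path_0)
next
  case (Suc r)
  obtain x Y where X: "X = add_mset x Y" and Y: "(\<Sum>x\<in>#Y. expo x) \<le> b"
  proof (cases "\<exists>x\<in>#X. expo x \<ge> 0")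
    case True
    then obtain x Y where "X = add_mset x Y" "expo x \<ge> 0"
      by (metis multi_member_split)
    then show ?thesis using Suc.prems that by auto
  next
    case False
    obtain x Y where X: "X = add_mset x Y"
      using Suc.prems(1) by (metis size_eq_Suc_imp_eq_union)
    have "(\<Sum>x\<in>#Y. expo x) \<le> (\<Sum>x\<in>#Y. 0)"
      using False X by (intro sum_mset_mono) auto
    then show ?thesis using X assms(3) that by auto
  qed
  have "has_path r (\<Sum>x\<in>#Y. expo x) (\<lambda>i s. s \<le> b)"
    using X Y Suc.prems(1) by (intro Suc.IH) auto
  then have "has_path (Suc r) ((\<Sum>x\<in>#Y. expo x) + expo x) (\<lambda>i s. s \<le> b)"
    using X Y by (intro has_path_Suc) auto
  then show ?case
    by (simp add: X add.commute)
qed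

text \<open>The path ends below 0. Stripping final steps \<open>N\<close> keeps the end negative, so
  the last step that leaves a trace also ends below 0.\<close>

lemma monom_of_negative_order:
  assumes "coef (dcoeff (L ^ r) t) m \<noteq> 0" "t < 0"
  shows "\<exists>i s. Poly_Mapping.lookup m (i, s) \<noteq> 0 \<and> s + Ns i < 0"
  using assms
proof (induction r arbitrary: t m)
  case 0
  then show ?case by (simp add: dcoeff_one)
next
  case (Suc r)
  have "(\<Sum>x\<in>UNIV. coef (dcoeff (L ^ r) (t - expo x) * shift (t - expo x) (factor x)) m) \<noteq> 0"
    using Suc.prems(1) by (simp only: dcoeff_power_Suc lookup_sum not_False_eq_True)
  then obtain x where x: "coef (dcoeff (L ^ r) (t - expo x) * shift (t - expo x) (factor x)) m \<noteq> 0"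
    by (metis (no_types, lifting) sum.neutral)
  show ?case
  proof (cases x)
    case None
    then show ?thesis
      using x Suc.IH[of "t - N" m] Suc.prems(2) N_pos by simp
  next
    case (Some i)
    then have "Poly_Mapping.lookup m (i, t - Ns i) \<noteq> 0"
      using x coef_mult_var_eq_0[of m i "t - Ns i"] by (auto simp: shift_var)
    then show ?thesis
      using Suc.prems(2) by (intro exI[of _ i] exI[of _ "t - Ns i"]) simp
  qed
qed


section \<open>Gaps in the support\<close>

text \<open>The coefficients of \<open>A * L\<close> and \<open>L * A\<close> at \<open>t\<close>
  agree, and both are sums of terms with natural coefficients; a monomial of a term of one must
  occur in a term of the other.\<close>

lemma dcoeff_commutator_eq_0_sums:
  assumes "dcoeff (commutator A L) t = 0" "\<And>s. nat_coeffs (dcoeff A s)"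
    and m: "coef (factor y * shift (expo y) (dcoeff A (t - expo y))) m \<noteq> 0"
  obtains x where "coef (dcoeff A (t - expo x) * shift (t - expo x) (factor x)) m \<noteq> 0"
proof -
  have nat: "coef (factor x * shift (expo x) (dcoeff A (t - expo x))) m \<in> \<nat>" for x
    using nat_coeffs_mult_factor[OF nat_coeffs_shift[OF assms(2)], of "expo x" "t - expo x" 0 x]
    by (simp add: nat_coeffs_def mult.commute)
  have "(\<Sum>x\<in>UNIV. coef (factor x * shift (expo x) (dcoeff A (t - expo x))) m) \<noteq> 0"
    using nat m by (intro sum_Nats_nonzero[of UNIV _ y]) auto
  moreover have "coef (dcoeff (A * L) t) m = coef (dcoeff (L * A) t) m"
    using assms(1) by (simp add: commutator_def dcoeff_minus)
  ultimately have "(\<Sum>x\<in>UNIV. coef (dcoeff A (t - expo x) * shift (t - expo x) (factor x)) m) \<noteq> 0"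
    by (simp add: dcoeff_mult_L dcoeff_L_mult lookup_sum)
  then show thesis
    using that by (metis (no_types, lifting) sum.neutral)
qed

text \<open>At a gap the commutator of \<open>L\<close> with the negative half of
  \<open>L ^ r\<close> vanishes. Putting a step \<open>N\<close> before the given path gives a
  monomial of \<open>L * ?B\<close> whose recorded steps all end at or above 0, whereas every
  monomial of \<open>?B * L\<close> has a recorded step ending below 0.\<close>

lemma no_gap_nonneg:
  assumes adm: "admissible (plus_part (L ^ r))" and t: "0 \<le> t" "t < N"
    and path: "has_path r (t - N) (\<lambda>i s. s + Ns i \<ge> - N)"
  shows "t \<in> range Ns"
proof (rule ccontr)
  assume "t \<notin> range Ns"
  let ?B = "minus_part (L ^ r)"
  have zero: "dcoeff (commutator ?B L) t = 0"
    using adm \<open>t \<notin> range Ns\<close>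
    by (simp add: admissible_def commutator_minus_part_power dcoeff_uminus)
  have nat: "nat_coeffs (dcoeff ?B s)" for s
    using nat_coeffs_power[of r s] by (auto simp: dcoeff_minus_part nat_coeffs_def)
  obtain m where m: "coef (dcoeff (L ^ r) (t - N)) m \<noteq> 0"
      "\<And>i s. Poly_Mapping.lookup m (i, s) \<noteq> 0 \<Longrightarrow> s + Ns i \<ge> - N"
    using path by (auto simp: has_path_def)
  have "coef (factor None * shift (expo None) (dcoeff ?B (t - expo None))) (mshift N m) \<noteq> 0"
    using m(1) t by (simp add: coef_shift_mshift dcoeff_minus_part)
  then obtain x where "coef (dcoeff ?B (t - expo x) * shift (t - expo x) (factor x)) (mshift N m) \<noteq> 0"
    using dcoeff_commutator_eq_0_sums[OF zero nat] by blast
  then obtain a b where ab: "mshift N m = a + b" "coef (dcoeff ?B (t - expo x)) a \<noteq> 0"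
    by (elim coef_mult_nonzeroE)
  then have "t - expo x < 0" "coef (dcoeff (L ^ r) (t - expo x)) a \<noteq> 0"
    by (auto simp: dcoeff_minus_part split: if_splits)
  then obtain i s where low: "Poly_Mapping.lookup a (i, s) \<noteq> 0" "s + Ns i < 0"
    using monom_of_negative_order by blast
  then have "Poly_Mapping.lookup (mshift N m) (i, s) \<noteq> 0"
    by (simp add: ab(1) lookup_add)
  then have "Poly_Mapping.lookup m (i, s - N) \<noteq> 0"
    by (simp add: lookup_mshift)
  then show False
    using m(2) low(2) by fastforce
qed

text \<open>Putting a step \<open>Ns trail\<close> before the given path gives a monomial of
  \<open>L * ?A\<close> whose recorded steps all start at or below 0. In \<open>?A * L\<close> the
  last step starts at or above 0 and ends at \<open>t\<close>, and at a gap this start is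
  positive.\<close>

lemma no_gap_neg:
  assumes adm: "admissible (plus_part (L ^ r))" and t: "Ns trail < t" "t < 0"
    and path: "has_path r (t - Ns trail) (\<lambda>i s. s \<le> - Ns trail)"
  shows "t \<in> range Ns"
proof (rule ccontr)
  assume gap: "t \<notin> range Ns"
  let ?A = "plus_part (L ^ r)" and ?y = "Some trail"
  have zero: "dcoeff (commutator ?A L) t = 0"
    using adm gap by (simp add: admissible_def)
  have nat: "nat_coeffs (dcoeff ?A s)" for s
    using nat_coeffs_power[of r s] by (auto simp: dcoeff_plus_part nat_coeffs_def)
  obtain m where m: "coef (dcoeff (L ^ r) (t - Ns trail)) m \<noteq> 0"
      "\<And>i s. Poly_Mapping.lookup m (i, s) \<noteq> 0 \<Longrightarrow> s \<le> - Ns trail"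
    using path by (auto simp: has_path_def)
  let ?m = "mshift (Ns trail) m + uvar (trail, 0)"
  have "coef (factor ?y * shift (expo ?y) (dcoeff ?A (t - expo ?y))) ?m \<noteq> 0"
    using m(1) t
    by (simp add: mult.commute[of "gen trail"] coef_mult_var coef_shift_mshift dcoeff_plus_part)
  then obtain x where x: "coef (dcoeff ?A (t - expo x) * shift (t - expo x) (factor x)) ?m \<noteq> 0"
    using dcoeff_commutator_eq_0_sums[OF zero nat] by blast
  then have "dcoeff ?A (t - expo x) \<noteq> 0"
    by auto
  then have "t - expo x \<ge> 0"
    by (auto simp: dcoeff_plus_part split: if_splits)
  \<comment> \<open>The last step is not \<open>N\<close>, so it leaves a trace; it is not
    \<open>t\<close> either, by the gap, so its starting point is not 0.\<close>
  moreover have "expo x \<noteq> N"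
    using \<open>t - expo x \<ge> 0\<close> t(2) N_pos by linarith
  moreover have "expo x \<noteq> t" if "x \<noteq> None"
    using that gap by (cases x) auto
  ultimately obtain i where i: "x = Some i" "t - Ns i > 0"
    by (cases x) auto
  then have "Poly_Mapping.lookup ?m (i, t - Ns i) \<noteq> 0"
    using x coef_mult_var_eq_0[of ?m i "t - Ns i"] by (auto simp: shift_var)
  then have "Poly_Mapping.lookup m (i, t - Ns i - Ns trail) \<noteq> 0"
    using i(2) by (simp add: lookup_add lookup_mshift lookup_single)
  then show False
    using m(2) i(2) by fastforce
qed


section \<open>Arithmetic of the exponents\<close>

lemma Gcd_int_Bezout:
  fixes f :: "'a \<Rightarrow> int"
  assumes "finite X"
  shows "\<exists>x. Gcd (f ` X) = (\<Sum>i\<in>X. x i * f i)"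
  using assms
proof induction
  case (insert a X)
  then obtain x where x: "Gcd (f ` X) = (\<Sum>i\<in>X. x i * f i)"
    by blast
  obtain u v where uv: "u * f a + v * Gcd (f ` X) = gcd (f a) (Gcd (f ` X))"
    using bezout_int by blast
  let ?x = "\<lambda>i. if i = a then u else v * x i"
  have "(\<Sum>i\<in>X. ?x i * f i) = v * (\<Sum>i\<in>X. x i * f i)"
    unfolding sum_distrib_left using insert.hyps by (intro sum.cong) auto
  then show ?case
    using insert.hyps uv x by (intro exI[of _ ?x]) (simp add: mult.commute)
qed simp

section \<open>The period and sums of a given number of exponents\<close>

definition period :: int where
  "period = (GCD i. N - Ns i)"

lemma period_dvd: "period dvd N - Ns i"
  unfolding period_def by (rule Gcd_dvd) simp

lemma period_pos: "period > 0"
proof -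
  have "period \<noteq> 0"
    using period_dvd[of trail] Ns_less[of trail] by auto
  moreover have "period \<ge> 0"
    unfolding period_def by simp
  ultimately show ?thesis by simp
qed

text \<open>Replacing a step \<open>N\<close> by \<open>Ns i\<close> lowers the sum by
  \<open>N - Ns i\<close>, so \<open>int r * N - s\<close> must be a combination of these
  differences with nonnegative coefficients of total at most \<open>r\<close>. Bezout gives integer
  coefficients; for large \<open>r\<close> they can be corrected.\<close>

lemma steps_exist:
  obtains r0 where "\<And>r s. r \<ge> r0 \<Longrightarrow> \<bar>s\<bar> \<le> N - Ns trail \<Longrightarrow> period dvd int r * N - s \<Longrightarrow>
    \<exists>X. size X = r \<and> (\<Sum>x\<in>#X. expo x) = s"
proof -
  define D where "D = N - Ns trail"
  define C where "C = int (card (UNIV :: 'm set))"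
  have D: "D > 0" "N < D"
    using N_pos Ns_trail_neg by (auto simp: D_def)
  have gap: "0 < N - Ns i" "N - Ns i \<le> D" for i
    using Ns_less[of i] Ns_ge_trail[of i] by (auto simp: D_def)
  have "\<exists>X. size X = r \<and> (\<Sum>x\<in>#X. expo x) = s"
    if r: "r \<ge> nat (C * D * D + D)" and s: "\<bar>s\<bar> \<le> D" and dvd: "period dvd int r * N - s" for r s
  proof -
    obtain x where x: "period = (\<Sum>i\<in>UNIV. x i * (N - Ns i))"
      using Gcd_int_Bezout[of UNIV "\<lambda>i. N - Ns i"] unfolding period_def by auto
    obtain w where w: "int r * N - s = period * w"
      using dvd by (elim dvdE)
    \<comment> \<open>Bezout coefficients are reduced modulo \<open>D\<close>; the carries,
      multiples of \<open>D\<close>, are collected in \<open>z\<close> and later assigned to the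
      trailing step, whose difference is exactly \<open>D\<close>.\<close>
    define y where "y i = (w * x i) mod D" for i
    define z where "z = (\<Sum>i\<in>UNIV. ((w * x i) div D) * (N - Ns i))"
    have y: "0 \<le> y i" "y i < D" for i
      using D by (auto simp: y_def)
    have "w * x i * (N - Ns i) = y i * (N - Ns i) + D * ((w * x i) div D * (N - Ns i))" for i
    proof -
      have "w * x i = y i + D * ((w * x i) div D)"
        by (simp add: y_def)
      then have "w * x i * (N - Ns i) = (y i + D * ((w * x i) div D)) * (N - Ns i)"
        by (rule arg_cong)
      then show ?thesis by (simp only: distrib_right mult.assoc)
    qed
    then have "(\<Sum>i\<in>UNIV. w * x i * (N - Ns i)) = (\<Sum>i\<in>UNIV. y i * (N - Ns i)) + D * z"
      by (simp add: sum.distrib z_def sum_distrib_left)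
    moreover have "int r * N - s = (\<Sum>i\<in>UNIV. w * x i * (N - Ns i))"
      unfolding w x by (simp add: sum_distrib_left sum_distrib_right mult_ac)
    ultimately have eq: "int r * N - s = (\<Sum>i\<in>UNIV. y i * (N - Ns i)) + D * z"
      by simp
    have "(\<Sum>i\<in>UNIV. y i * (N - Ns i)) \<le> (\<Sum>i\<in>(UNIV::'m set). D * D)"
      using y gap D(1) by (intro sum_mono mult_mono) (auto simp: order.strict_implies_order)
    then have ySum: "(\<Sum>i\<in>UNIV. y i * (N - Ns i)) \<le> C * D * D"
      by (simp add: C_def)
    have ySum0: "(\<Sum>i\<in>UNIV. y i * (N - Ns i)) \<ge> 0"
      using y(1) gap(1) by (intro sum_nonneg mult_nonneg_nonneg) (auto simp: order.strict_implies_order)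
    have "(\<Sum>i\<in>UNIV. y i) \<le> (\<Sum>i\<in>(UNIV::'m set). D)"
      using y(2) by (intro sum_mono) (auto simp: order.strict_implies_order)
    then have ySum1: "(\<Sum>i\<in>UNIV. y i) \<le> C * D"
      by (simp add: C_def)
    have r': "int r \<ge> C * D * D + D"
      using r by linarith
    have "int r * 1 \<le> int r * N"
      using N_pos by (intro mult_left_mono) auto
    then have "int r \<le> int r * N"
      by simp
    then have "D * z \<ge> 0"
      using eq ySum r' s by linarith
    then have z0: "z \<ge> 0"
      using D(1) by (simp add: zero_le_mult_iff)
    \<comment> \<open>Because \<open>N < D\<close>, the total of the carries grows more slowly than
      \<open>r\<close>, which leaves room for the bounded contribution of the
      \<open>y i\<close>.\<close>
    have "D * z \<le> int r * N + D"
      using eq ySum0 s by linarith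
    also have "\<dots> \<le> int r * (D - 1) + D"
      using D(2) by (simp add: mult_left_mono)
    also have "\<dots> \<le> D * (int r - C * D)"
      using r' by (simp add: algebra_simps)
    finally have z1: "z \<le> int r - C * D"
      using D(1) by simp
    define k where "k i = nat (y i + (if i = trail then z else 0))" for i
    have k: "int (k i) = y i + (if i = trail then z else 0)" for i
      using y(1)[of i] z0 by (simp add: k_def)
    have kSum: "int (\<Sum>i\<in>UNIV. k i) = (\<Sum>i\<in>UNIV. y i) + z"
      by (simp add: k sum.distrib)
    then have kle: "(\<Sum>i\<in>UNIV. k i) \<le> r"
      using ySum1 z1 by linarith
    have kexp: "(\<Sum>i\<in>UNIV. int (k i) * (N - Ns i)) = int r * N - s"
    proof -
      have "(\<Sum>i\<in>UNIV. int (k i) * (N - Ns i)) =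
          (\<Sum>i\<in>UNIV. y i * (N - Ns i) + (if i = trail then z * (N - Ns i) else 0))"
        by (rule sum.cong) (auto simp: k algebra_simps)
      also have "\<dots> = (\<Sum>i\<in>UNIV. y i * (N - Ns i)) + z * D"
        by (simp add: sum.distrib D_def)
      finally show ?thesis using eq by (simp only: mult.commute[of z D])
    qed
    define X where "X = (\<Sum>i\<in>UNIV. replicate_mset (k i) (Some i)) + replicate_mset (r - (\<Sum>i\<in>UNIV. k i)) None"
    have "size X = r"
      using kle by (simp add: X_def size_multiset_sum)
    moreover have "(\<Sum>x\<in>#X. expo x) = s"
    proof -
      have img: "(\<Sum>x\<in>#(\<Sum>i\<in>Y. replicate_mset (k i) (Some i)). expo x) = (\<Sum>i\<in>Y. int (k i) * Ns i)" for Y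
        by (induction Y rule: infinite_finite_induct) (simp_all add: image_replicate_mset sum_mset_replicate_mset)
      have "(\<Sum>x\<in>#X. expo x) = (\<Sum>i\<in>UNIV. int (k i) * Ns i) + (int r - int (\<Sum>i\<in>UNIV. k i)) * N"
        unfolding X_def using kle by (simp add: img image_replicate_mset sum_mset_replicate_mset of_nat_diff del: of_nat_sum)
      also have "\<dots> = int r * N - (\<Sum>i\<in>UNIV. int (k i) * (N - Ns i))"
        by (simp add: right_diff_distrib sum_subtractf sum_distrib_right left_diff_distrib)
      finally show ?thesis by (simp add: kexp)
    qed
    ultimately show ?thesis by blast
  qed
  then show thesis
    using that unfolding D_def by blast
qed

text \<open>For some large \<open>r\<close> the operator \<open>plus_part (L ^ r)\<close> is
  admissible and the required paths exist, which excludes gaps congruent to \<open>(r + 1) N\<close>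
  modulo the period. It remains to see that this is the residue class of \<open>N\<close>.\<close>

lemma exponents_arithmetic:
  assumes F: "infinite F" "\<And>\<delta>. \<delta> \<in> F \<Longrightarrow> lax_flow N Ns \<delta>" "flows.independent F"
    and t: "Ns trail \<le> t" "t < N" "period dvd N - t"
  shows "t \<in> range Ns"
proof -
  obtain r0 where r0: "\<And>r s. r \<ge> r0 \<Longrightarrow> \<bar>s\<bar> \<le> N - Ns trail \<Longrightarrow> period dvd int r * N - s \<Longrightarrow>
    \<exists>X. size X = r \<and> (\<Sum>x\<in>#X. expo x) = s"
    using steps_exist by blast
  \<comment> \<open>The bound on the order ensures both \<open>r0 \<le> r\<close> for the later
    quotient \<open>r\<close> and, through the summand 1, the strict inequality of
    \<open>dvd_admissible_order\<close>.\<close>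
  obtain A n c where A: "admissible A" "\<And>k. k < 0 \<Longrightarrow> dcoeff A k = 0" "\<And>k. n < k \<Longrightarrow> dcoeff A k = 0"
    "dcoeff A n = Const c" "c \<noteq> 0" and n: "int (r0 * nat N + nat (N - Ns lead) + 1) \<le> n"
    using infinite_flows_unbounded_order[OF F] by blast
  have n': "int r0 * N \<le> n" "N - Ns lead < n"
  proof -
    have "int r0 * N \<ge> 0"
      using N_pos by simp
    moreover have "int r0 * N + (N - Ns lead) + 1 \<le> n"
      using n N_pos Ns_less[of lead] by simp
    ultimately show "int r0 * N \<le> n" "N - Ns lead < n"
      using Ns_less[of lead] by linarith+
  qed
  have "N dvd n"
    using A n'(2) by (intro dvd_admissible_order[of A n c])
  moreover have "n \<ge> 0"
    using n'(2) Ns_less[of lead] by linarith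
  ultimately obtain r where r: "n = int r * N"
    using N_pos by (metis dvdE mult.commute zero_le_imp_eq_int zero_le_mult_iff not_less)
  then have "r \<ge> r0"
    using n'(1) N_pos by simp
  have adm: "admissible (plus_part (L ^ r))"
    by (rule admissible_imp_admissible_power[OF A r])
  have inner: "t \<in> range Ns"
    if t: "Ns trail < t" "t < N" "period dvd int (Suc r) * N - t" for t
  proof (cases "t \<ge> 0")
    case True
    have "int r * N - (t - N) = int (Suc r) * N - t"
      by (simp add: algebra_simps)
    then have "period dvd int r * N - (t - N)"
      using t(3) by (simp only:)
    then obtain X where "size X = r" "(\<Sum>x\<in>#X. expo x) = t - N"
      using r0[OF \<open>r \<ge> r0\<close>, of "t - N"] t(1,2) by auto
    then have "has_path r (t - N) (\<lambda>i s. s + Ns i \<ge> - N)"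
      using has_path_above[of X r "- N"] True N_pos by simp
    then show ?thesis
      using no_gap_nonneg adm True t(2) by blast
  next
    case False
    have "int r * N - (t - Ns trail) = int (Suc r) * N - t - (N - Ns trail)"
      by (simp add: algebra_simps)
    then have "period dvd int r * N - (t - Ns trail)"
      using t(3) period_dvd[of trail] by (metis dvd_diff)
    then obtain X where "size X = r" "(\<Sum>x\<in>#X. expo x) = t - Ns trail"
      using r0[OF \<open>r \<ge> r0\<close>, of "t - Ns trail"] t by auto
    then have "has_path r (t - Ns trail) (\<lambda>i s. s \<le> - Ns trail)"
      using has_path_below[of X r "- Ns trail"] False Ns_trail_neg by simp
    then show ?thesis
      using no_gap_neg adm False t(1) by force
  qed
  \<comment> \<open>Otherwise \<open>inner\<close> would produce an exponent \<open>N - e\<close>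
    with \<open>0 < e < period\<close>, although the period divides all differences
    \<open>N - Ns i\<close>.\<close>
  have "period dvd int r * N"
  proof (rule ccontr)
    assume ndvd: "\<not> period dvd int r * N"
    define e where "e = (- (int r * N)) mod period"
    have "e \<noteq> 0"
      using ndvd by (metis e_def dvd_eq_mod_eq_0 dvd_minus_iff)
    then have e: "0 < e" "e < period"
      using period_pos pos_mod_bound[of period] pos_mod_sign[of period] by (auto simp: e_def order_less_le)
    have "period \<le> N - Ns trail"
      using period_dvd[of trail] Ns_less[of trail] by (simp add: zdvd_imp_le)
    moreover have "period dvd int (Suc r) * N - (N - e)"
    proof -
      have "period dvd e - (- (int r * N))"
        unfolding e_def by (metis mod_eq_dvd_iff mod_mod_trivial)
      then show ?thesis by (simp add: algebra_simps)
    qed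
    ultimately have "N - e \<in> range Ns"
      using e by (intro inner) auto
    then obtain i where "N - e = Ns i"
      by blast
    then have "e = N - Ns i"
      by simp
    then have "period dvd e"
      using period_dvd by simp
    then show False
      using e zdvd_not_zless by blast
  qed
  then have "period dvd int r * N + (N - t)"
    using t(3) by (rule dvd_add)
  then show ?thesis
    using inner[of t] t by (cases "t = Ns trail") (auto simp: algebra_simps)
qed

text \<open>For large \<open>k\<close> there is a closed path of length \<open>q * k\<close> at 0,
  so the residue is nonzero; these residues are homogeneous of weight \<open>q * k * N\<close>,
  hence pairwise different.\<close>

lemma infinite_Res_powers:
  assumes "q > 0" "period dvd int q * N"
  shows "infinite ((\<lambda>k. Res (L ^ (q * k))) ` {0<..})"
proof -
  obtain r0 where r0: "\<And>r s. r \<ge> r0 \<Longrightarrow> \<bar>s\<bar> \<le> N - Ns trail \<Longrightarrow> period dvd int r * N - s \<Longrightarrow>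
    \<exists>X. size X = r \<and> (\<Sum>x\<in>#X. expo x) = s"
    using steps_exist by blast
  have nonzero: "Res (L ^ (q * k)) \<noteq> 0" if "k > r0" for k
  proof -
    have "r0 \<le> 1 * k"
      using that by simp
    also have "\<dots> \<le> q * k"
      using assms(1) by (intro mult_le_mono1) simp
    finally have "r0 \<le> q * k" .
    moreover have "period dvd int (q * k) * N - 0"
      using dvd_mult[OF assms(2), of "int k"] by (simp add: mult_ac)
    ultimately obtain X where "size X = q * k" "(\<Sum>x\<in>#X. expo x) = 0"
      using r0[of "q * k" 0] Ns_less[of trail] by auto
    then have "has_path (q * k) 0 (\<lambda>i s. s \<le> 0)"
      using has_path_below[of X "q * k" 0] by simp
    then show ?thesis
      by (auto simp: has_path_def Res_def)
  qed
  have "inj_on (\<lambda>k. Res (L ^ (q * k))) {r0<..}"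
  proof (rule inj_onI)
    fix k k' assume k: "k \<in> {r0<..}" "k' \<in> {r0<..}" and eq: "Res (L ^ (q * k)) = Res (L ^ (q * k'))"
    obtain m where m: "coef (Res (L ^ (q * k))) m \<noteq> 0"
      using nonzero[of k] k by (metis greaterThan_iff lookup_zero poly_mapping_eqI)
    have weight: "mweight wgt m = int r * N" if "coef (Res (L ^ r)) m \<noteq> 0" for r
      using that arg_cong[OF hpart_power[of r], of "\<lambda>P. coef (dcoeff P 0) m"]
      by (auto simp: dcoeff_hpart coef_wpart Res_def split: if_splits)
    have "int (q * k) * N = int (q * k') * N"
      using weight[OF m] weight[of "q * k'"] m eq by simp
    then show "k = k'"
      using N_pos assms(1) by simp
  qed
  then have "infinite ((\<lambda>k. Res (L ^ (q * k))) ` {r0<..})"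
    using finite_imageD infinite_Ioi by blast
  then show ?thesis
    by (rule infinite_super[rotated]) auto
qed

end

theorem theorem4:
  fixes N p m :: int and Ns :: "'m::{finite,linorder} \<Rightarrow> int" and q :: nat
  assumes "N > 0"
    and "\<And>i. N > Ns i"
    and "\<And>i j. i < j \<Longrightarrow> Ns i > Ns j"
    and "Ns (Max UNIV) < 0"
    and "p = (GCD i. N - Ns i)"
    and "q = nat (p div gcd p N)"
    and "m = (N - Ns (Max UNIV)) div p"
    and "\<exists>F. infinite F \<and> (\<forall>\<delta>\<in>F. lax_flow N Ns \<delta>) \<and> flows.independent F"
  shows "supp (lax_op N Ns) = {N - j * p | j. 0 \<le> j \<and> j \<le> m} \<and>
    (\<exists>!\<delta>. lax_hierarchy N Ns q \<delta>) \<and>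
    (\<forall>\<delta>. lax_hierarchy N Ns q \<delta> \<longrightarrow>
      (\<forall>k>0. \<forall>k'>0. \<delta> k (Res (lax_op N Ns ^ (q * k'))) \<in> total_differences)) \<and>
    infinite ((\<lambda>k. Res (lax_op N Ns ^ (q * k))) ` {0<..})"
proof -
  interpret lax_operator N Ns
    using assms(1-4) by unfold_locales
  have p: "p = period"
    by (simp add: assms(5) period_def)
  have full: "t \<in> range Ns" if "Ns trail \<le> t" "t < N" "p dvd N - t" for t
    using assms(8) exponents_arithmetic that unfolding p by blast
  have pdvd: "p dvd N - Ns i" for i
    unfolding p by (rule period_dvd)
  have p0: "p > 0"
    unfolding p by (rule period_pos)
  have m: "m * p = N - Ns trail"
    using pdvd[of trail] by (simp add: assms(7) trail_def)
  \<comment> \<open>With \<open>N\<close> written as a multiple of the gcd, this shows that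
    \<open>p\<close> divides \<open>q * N\<close>, so powers with exponent \<open>q * k\<close> have
    orders divisible by \<open>p\<close>.\<close>
  have "int q * gcd p N = p"
    using p0 by (simp add: assms(6) pos_imp_zdiv_nonneg_iff)
  then have q: "q > 0"
    using p0 by (cases "q = 0") auto
  obtain N' where N': "N = gcd p N * N'"
    by (metis dvdE gcd_dvd2)
  have qN: "p dvd int q * N"
  proof -
    have "int q * N = int q * gcd p N * N'"
      using N' by (metis mult.assoc)
    then show ?thesis
      by (simp add: \<open>int q * gcd p N = p\<close>)
  qed
  have qkN: "p dvd int (q * k) * N" for k
    using dvd_mult[OF qN, of "int k"] by (simp add: mult_ac)
  have supp: "supp L = {N - j * p | j. 0 \<le> j \<and> j \<le> m}"
  proof (intro set_eqI iffI)
    fix t assume "t \<in> supp L"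
    then consider "t = N" | i where "t = Ns i"
      by (auto simp: supp_L)
    then obtain j where j: "N - t = p * j" and t: "Ns trail \<le> t" "t \<le> N"
    proof cases
      case 1
      then show ?thesis
        using that[of 0] Ns_less[of trail] by simp
    next
      case (2 i)
      then show ?thesis
        using that pdvd[of i] Ns_ge_trail[of i] Ns_less[of i] by (auto elim!: dvdE)
    qed
    have "0 \<le> p * j" "p * j \<le> m * p"
      using j m t by auto
    then have "0 \<le> j" "j \<le> m"
      using p0 by (simp_all add: zero_le_mult_iff mult.commute[of p])
    then show "t \<in> {N - j * p | j. 0 \<le> j \<and> j \<le> m}"
      using j by (auto intro!: exI[of _ j] simp: algebra_simps)
  next
    fix t assume "t \<in> {N - j * p | j. 0 \<le> j \<and> j \<le> m}"
    then obtain j where j: "t = N - j * p" "0 \<le> j" "j \<le> m"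
      by blast
    show "t \<in> supp L"
    proof (cases "j = 0")
      case False
      have "j * p \<le> m * p"
        using j(3) p0 by (intro mult_right_mono) auto
      moreover have "0 < j * p"
        using False j(2) p0 by simp
      ultimately have "t \<in> range Ns"
        using m by (intro full) (auto simp: j(1))
      then show ?thesis by (simp add: supp_L)
    qed (simp add: j(1) supp_L)
  qed
  have "\<exists>!\<delta>. lax_hierarchy N Ns q \<delta>"
    by (intro ex1_lax_hierarchy admissible_plus_part_power[OF pdvd qkN full])
  moreover have "\<delta> k (Res (L ^ (q * k'))) \<in> total_differences"
    if "lax_hierarchy N Ns q \<delta>" "k > 0" for \<delta> k k'
    using that by (intro conserved_Res_power) (auto simp: lax_hierarchy_def)
  moreover have "infinite ((\<lambda>k. Res (L ^ (q * k))) ` {0<..})"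
    using infinite_Res_powers[OF q] qN by (simp add: p)
  ultimately show ?thesis
    using supp by (simp add: L_def)
qed

end
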